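(* Let $P$ be a finite set of primes, let $b\ge2$ be an integer relatively prime to every prime in $P$, and let $0<\epsilon<1$. There is a constant $c>0$ depending on $P$ such that for all sufficiently large $m\in\mathbb{N}_P$, all integers $a$ with $1\le a<m$ and $\gcd(a,m)=1$, all base-$b$ strings $s=[d_1,d_2,\dots,d_k]$, and all $N$ satisfying \[ \exp\!\left(\frac{(1+\epsilon)\log m}{\log_2\log m}\right)\le N, \] we have \[ \mathcal{N}_{a,m,s}(N)=\frac{1}{b^k}N+O\!\left(N\exp\!\left(-c(\log\log m)^{3/2}\right)\right), \] where the implicit constant may depend on $P$, $b$ and $\epsilon$.
   Context: $\mathbb{N}_P$ is the set of positive integers all of whose prime factors lie in $P$. Writing the base-$b$ expansion $\frac{a}{m}=0.a_1a_2a_3\dots$ and given a string of base-$b$ digits $s=[d_1,\dots,d_k]$, $\mathcal{N}_{a,m,s}(N)=\#\{1\le n\le N: a_{n-1+i}=d_i\text{ for }1\le i\le k\}$. $\log$ is the natural logarithm and $\log_2$ the base-2 logarithm. *)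

theory Defs
  imports Complex_Main "HOL-Computational_Algebra.Primes"
begin

definition integers_over :: "nat set \<Rightarrow> nat set" where
  "integers_over P = {n. n > 0 \<and> (\<forall>p. prime p \<and> p dvd n \<longrightarrow> p \<in> P)}"

text \<open>
  For \<open>0 \<le> x < 1\<close> the digit \<open>base_digit b x i\<close> (\<open>i \<ge> 1\<close>) is \<open>d\<^sub>i\<close> in
  \<open>x = 0.d\<^sub>1d\<^sub>2d\<^sub>3\<dots>\<close>; see \<open>base_digit_sums\<close> below. If \<open>x\<close> has two
  expansions, this is the terminating one. That does not arise for \<open>x = a/m\<close> in lowest terms
  with \<open>m > 1\<close> coprime to \<open>b\<close>.
\<close>

definition base_digit :: "nat \<Rightarrow> real \<Rightarrow> nat \<Rightarrow> nat" where
  "base_digit b x i = nat (\<lfloor>x * real b ^ i\<rfloor> mod int b)"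

lemma base_digit_less: "b > 0 \<Longrightarrow> base_digit b x i < b"
  by (simp add: base_digit_def nat_less_iff)

lemma base_digit_sums:
  assumes b: "b \<ge> 2" and x: "0 \<le> x" "x < 1"
  shows "(\<lambda>i. real (base_digit b x (Suc i)) / real b ^ Suc i) sums x"
proof -
  have b0: "real b > 0" using b by simp
  have part: "(\<Sum>i<n. real (base_digit b x (Suc i)) / real b ^ Suc i)
              = of_int \<lfloor>x * real b ^ n\<rfloor> / real b ^ n" for n
  proof (induction n)
    case 0
    have "\<lfloor>x\<rfloor> = 0" using x by (simp add: floor_eq_iff)
    then show ?case by simp
  next
    case (Suc n)
    let ?F = "\<lfloor>x * real b ^ Suc n\<rfloor>"
    have "?F div int b = \<lfloor>x * real b ^ Suc n / real b\<rfloor>"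
      using floor_divide_real_eq_div[of "int b" "x * real b ^ Suc n"] by simp
    also have "x * real b ^ Suc n / real b = x * real b ^ n"
      using b0 by (simp add: field_simps)
    finally have "?F div int b = \<lfloor>x * real b ^ n\<rfloor>" .
    then have "?F = int b * \<lfloor>x * real b ^ n\<rfloor> + ?F mod int b"
      by (metis mult_div_mod_eq)
    moreover have "int (base_digit b x (Suc n)) = ?F mod int b"
      using b by (simp add: base_digit_def)
    ultimately have "?F = int b * \<lfloor>x * real b ^ n\<rfloor> + int (base_digit b x (Suc n))"
      by simp
    then have "real_of_int ?F
        = real b * of_int \<lfloor>x * real b ^ n\<rfloor> + real (base_digit b x (Suc n))"
      by (metis of_int_add of_int_mult of_int_of_nat_eq)
    then show ?case using Suc.IH b0 by (simp add: field_simps)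
  qed
  have "(\<lambda>n. of_int \<lfloor>x * real b ^ n\<rfloor> / real b ^ n) \<longlonglongrightarrow> x"
  proof (rule tendsto_sandwich)
    have "(\<lambda>n. (1 / real b) ^ n) \<longlonglongrightarrow> 0"
      using b by (intro LIMSEQ_power_zero) auto
    from tendsto_diff[OF tendsto_const this, of x]
    show "(\<lambda>n. x - (1 / real b) ^ n) \<longlonglongrightarrow> x" by simp
    show "\<forall>\<^sub>F n in sequentially.
        x - (1 / real b) ^ n \<le> of_int \<lfloor>x * real b ^ n\<rfloor> / real b ^ n"
    proof (intro always_eventually allI)
      fix n
      have "x * real b ^ n - 1 \<le> of_int \<lfloor>x * real b ^ n\<rfloor>" by linarith
      then have "(x * real b ^ n - 1) / real b ^ n \<le> of_int \<lfloor>x * real b ^ n\<rfloor> / real b ^ n"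
        using b0 by (intro divide_right_mono) auto
      moreover have "(x * real b ^ n - 1) / real b ^ n = x - (1 / real b) ^ n"
        using b0 by (simp add: field_simps)
      ultimately show "x - (1 / real b) ^ n \<le> of_int \<lfloor>x * real b ^ n\<rfloor> / real b ^ n" by simp
    qed
    show "\<forall>\<^sub>F n in sequentially. of_int \<lfloor>x * real b ^ n\<rfloor> / real b ^ n \<le> x"
      using b0 by (intro always_eventually allI) (simp add: divide_le_eq)
  qed simp
  then show ?thesis unfolding sums_def part .
qed

text \<open>The string \<open>[d\<^sub>1, \<dots>, d\<^sub>k]\<close> is a list indexed from \<open>0\<close>, so \<open>d\<^sub>i\<close> is \<open>s ! (i - 1)\<close>.\<close>

definition base_string :: "nat \<Rightarrow> nat list \<Rightarrow> bool" where
  "base_string b s \<longleftrightarrow> (\<forall>d\<in>set s. d < b)"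

definition string_count :: "nat \<Rightarrow> nat \<Rightarrow> nat \<Rightarrow> nat list \<Rightarrow> nat \<Rightarrow> nat" where
  "string_count b a m s N =
     card {n. 1 \<le> n \<and> n \<le> N \<and>
       (\<forall>i. 1 \<le> i \<and> i \<le> length s \<longrightarrow>
          base_digit b (real a / real m) (n - 1 + i) = s ! (i - 1))}"

end

(*
  A string s of length k occurs at place n iff a b^(n-1) mod m lies in an interval of length about
  m / b^k, so the count is governed by the exponential sums over n < N of e(h a b^n / m).
  Let L = log m. Some prime p in P satisfies m <= (p^e)^card P, where p^e exactly divides m. Choose
  r about log_2 L / (1 + epsilon/2) and T about m^(1/r), smaller than N, such that G = b^T is congruent
  to 1 modulo p^s Y, where Y^r is a multiple of the p-free part of m and r s is slightly below e.
  On a residue class mod T the phase is theta G^k, and Weyl differencing by h replaces theta by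
  theta (G^h - 1): each step removes a factor p^s Y from the denominator, and also the p-part
  of h. Unless that p-part is exceptionally large, a geometric sum over a small power of p
  remains after r - 1 steps. The 2^(r-1)-th root lost in the process is only
  L^(1/(1 + epsilon/2)), so a saving of exp (- L / (log L)^3) at the bottom suffices.
*)

theory Submission
  imports Defs "HOL-Number_Theory.Number_Theory" "HOL-Real_Asymp.Real_Asymp"
begin

subsection \<open>Exponential sums\<close>

text \<open>Only one prime is followed exactly. At p the valuation of G^h - 1 is known precisely,
  which keeps the numerators prime to p and the last geometric sum nontrivial; at the other primes
  bare divisibility by Y is enough. The demands on r pull in opposite directions: r must be large
  for T to stay below N, and small for the repeated square roots to leave a saving. The gap between
  \<epsilon>/2 and \<epsilon> pays for all secondary factors. The cube in exp(- L/(log L)^3)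
  reflects the room in the exponent of p: a shift may lose up to V, about L/(log L)^3, in each of r
  steps, and the total must stay below s, about e/r. Hence r^2 V, of order L/log L, has to be small
  against e, which is at least of order L. What survives, exp(- L^(1-\<mu>)/(log L)^3) with \<mu> =
  1/(1 + \<epsilon>/2), beats every exp(- A (log L)^(3/2)), so c = 1 can be taken.\<close>

definition unit_exp :: "real \<Rightarrow> complex" where
  "unit_exp x = cis (2 * pi * x)"

lemma unit_exp_add: "unit_exp (x + y) = unit_exp x * unit_exp y"
  by (simp add: unit_exp_def cis_mult algebra_simps)

lemma unit_exp_of_int [simp]: "unit_exp (of_int k) = 1"
  by (simp add: unit_exp_def cis_multiple_2pi)

lemma unit_exp_add_of_int [simp]: "unit_exp (x + of_int k) = unit_exp x"
  by (simp add: unit_exp_add)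

lemma norm_unit_exp [simp]: "norm (unit_exp x) = 1"
  by (simp add: unit_exp_def)

lemma cnj_unit_exp: "cnj (unit_exp x) = unit_exp (- x)"
  by (simp add: unit_exp_def cis_cnj)

lemma unit_exp_power: "unit_exp x ^ n = unit_exp (real n * x)"
  by (simp add: unit_exp_def DeMoivre mult_ac)

lemma unit_exp_eq_1_iff: "unit_exp x = 1 \<longleftrightarrow> x \<in> \<int>"
proof
  assume "unit_exp x = 1"
  then have "cos (2 * pi * x) = 1"
    by (simp add: unit_exp_def complex_eq_iff)
  then obtain k :: int where "2 * pi * x = of_int k * 2 * pi"
    by (auto simp: cos_one_2pi_int)
  then have "x = of_int k" by simp
  then show "x \<in> \<int>" by simp
qed (auto elim!: Ints_cases)

lemma norm_sum_le_card:
  fixes f :: "'a \<Rightarrow> complex"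
  assumes "\<And>x. x \<in> A \<Longrightarrow> norm (f x) \<le> 1"
  shows "norm (sum f A) \<le> real (card A)"
  using sum_norm_bound[of A f 1] assms by simp

lemma sum_mult_cnj_sum:
  fixes z :: "nat \<Rightarrow> complex"
  shows "(\<Sum>k<K. z k) * cnj (\<Sum>k<K. z k) =
    (\<Sum>k<K. z k * cnj (z k)) + (\<Sum>i<K. \<Sum>j<i. z i * cnj (z j)) + cnj (\<Sum>i<K. \<Sum>j<i. z i * cnj (z j))"
proof (induction K)
  case (Suc K)
  have "(\<Sum>k<Suc K. z k) * cnj (\<Sum>k<Suc K. z k) = (\<Sum>k<K. z k) * cnj (\<Sum>k<K. z k) +
    z K * cnj (z K) + (\<Sum>j<K. z K * cnj (z j)) + cnj (\<Sum>j<K. z K * cnj (z j))"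
    by (simp add: ring_distribs sum_distrib_left[symmetric] sum_distrib_right[symmetric])
  then show ?case
    unfolding Suc.IH by (simp add: algebra_simps)
qed simp

text \<open>Substituting h = i - j makes the shift the outer variable, the form needed for
  differencing.\<close>

lemma sum_lower_triangle_diagonals:
  fixes f :: "nat \<Rightarrow> nat \<Rightarrow> 'a :: comm_monoid_add"
  shows "(\<Sum>i<K. \<Sum>j<i. f i j) = (\<Sum>h\<in>{1..<K}. \<Sum>k<K-h. f (k + h) k)"
proof -
  have "(\<Sum>i<K. \<Sum>j<i. f i j) = (\<Sum>(i,j)\<in>Sigma {..<K} (\<lambda>i. {..<i}). f i j)"
    by (subst sum.Sigma) auto
  also have "\<dots> = (\<Sum>(h,k)\<in>Sigma {1..<K} (\<lambda>h. {..<K-h}). f (k + h) k)"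
    by (rule sum.reindex_bij_witness[where i = "\<lambda>(h,k). (k + h, k)" and j = "\<lambda>(i,j). (i - j, j)"]) auto
  also have "\<dots> = (\<Sum>h\<in>{1..<K}. \<Sum>k<K-h. f (k + h) k)"
    by (subst sum.Sigma) auto
  finally show ?thesis .
qed

text \<open>Weyl's differencing inequality: the squared sum is its diagonal, equal to K, plus the
  lower triangle and its conjugate, and the triangle is sorted by shifts.\<close>

lemma norm_sum_square_le:
  fixes z :: "nat \<Rightarrow> complex"
  assumes "\<And>k. norm (z k) = 1"
  shows "(norm (\<Sum>k<K. z k))\<^sup>2 \<le>
    real K + 2 * (\<Sum>h\<in>{1..<K}. norm (\<Sum>k<K-h. z (k + h) * cnj (z k)))"
proof -
  define Q where "Q = (\<Sum>h\<in>{1..<K}. \<Sum>k<K-h. z (k + h) * cnj (z k))"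
  have "complex_of_real ((norm (\<Sum>k<K. z k))\<^sup>2) = (\<Sum>k<K. z k) * cnj (\<Sum>k<K. z k)"
    by (rule complex_norm_square)
  also have "\<dots> = (\<Sum>k<K. z k * cnj (z k)) + Q + cnj Q"
    unfolding sum_mult_cnj_sum sum_lower_triangle_diagonals Q_def ..
  also have "(\<Sum>k<K. z k * cnj (z k)) = of_nat K"
    using assms by (simp add: complex_norm_square[symmetric])
  finally have "norm (complex_of_real ((norm (\<Sum>k<K. z k))\<^sup>2)) = norm (of_nat K + Q + cnj Q)"
    by simp
  also have "\<dots> \<le> real K + norm Q + norm Q"
    using norm_triangle_ineq[of "of_nat K + Q" "cnj Q"] norm_triangle_ineq[of "of_nat K" Q] by simp
  also have "norm Q \<le> (\<Sum>h\<in>{1..<K}. norm (\<Sum>k<K-h. z (k + h) * cnj (z k)))"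
    unfolding Q_def by (rule norm_sum)
  finally show ?thesis by (simp add: norm_power)
qed

text \<open>Complete periods cancel, so only an incomplete one with at most q terms is left.\<close>

lemma norm_geometric_sum_root_of_unity:
  fixes \<zeta> :: complex
  assumes "\<zeta> ^ q = 1" "\<zeta> \<noteq> 1" "q > 0"
  shows "norm (\<Sum>k<K. \<zeta> ^ k) \<le> real q"
proof -
  have "norm \<zeta> = 1"
    using assms by (metis norm_one norm_power power_eq_1_iff bot_nat_0.not_eq_extremum)
  have "\<zeta> ^ K = \<zeta> ^ (K mod q)"
    using assms(1) by (metis mult_div_mod_eq power_add power_mult power_one mult_1)
  then have "(\<Sum>k<K. \<zeta> ^ k) = (\<Sum>k<K mod q. \<zeta> ^ k)"
    using assms(2) by (simp add: sum_gp_strict)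
  also have "norm \<dots> \<le> real (K mod q)"
    using norm_sum_le_card[of "{..<K mod q}" "\<lambda>k. \<zeta> ^ k"] \<open>norm \<zeta> = 1\<close> by (simp add: norm_power)
  also have "\<dots> \<le> real q" using assms(3) by (simp add: less_imp_le)
  finally show ?thesis .
qed

lemma card_multiples_le:
  fixes d K :: nat
  assumes "d > 0"
  shows "real (card {h\<in>{1..<K}. d dvd h}) \<le> real K / real d"
proof -
  have "{h\<in>{1..<K}. d dvd h} \<subseteq> (\<lambda>i. d * i) ` {1..K div d}"
    using assms by (auto elim!: dvdE simp: less_eq_div_iff_mult_less_eq mult.commute Suc_le_eq intro!: imageI)
  then have "card {h\<in>{1..<K}. d dvd h} \<le> card ((\<lambda>i. d * i) ` {1..K div d})"
    by (intro card_mono) auto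
  also have "\<dots> \<le> K div d"
    using card_image_le[of "{1..K div d}" "\<lambda>i. d * i"] by simp
  finally have "real (card {h\<in>{1..<K}. d dvd h}) \<le> real (K div d)" by simp
  also have "\<dots> \<le> real K / real d" by (rule of_nat_div_le_of_nat)
  finally show ?thesis .
qed

subsection \<open>Lifting the exponent\<close>

lemma sum_powers_cong:
  fixes x q :: int
  assumes "[x = 1] (mod q)"
  shows "[(\<Sum>i<h. x ^ i) = int h] (mod q)"
proof -
  have "[(\<Sum>i<h. x ^ i) = (\<Sum>i<h. 1 ^ i)] (mod q)"
    by (intro cong_sum cong_pow assms)
  then show ?thesis by simp
qed

lemma power_minus_1_eq: "x ^ n - 1 = (x - 1) * (\<Sum>i<n. x ^ i)" for x :: int
  using power_diff_1_eq[of x n] by simp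

text \<open>Lifting the exponent, by induction on \<open>v\<close> with \<open>x\<close> replaced by
  x^p. Since s \<ge> 2, the sum of the first p powers of x is p modulo p^2, so exactly one factor p
  is gained, also for p = 2. The factor \<open>y\<close> is carried along separately because it will
  contain the p-free part of the modulus.\<close>

lemma power_diff_1_lifting:
  fixes x y :: int and p :: nat
  assumes p: "prime p" and s: "s \<ge> 2" and x: "x - 1 = int p ^ s * y" and h: "\<not> p dvd h"
  shows "\<exists>c. x ^ (p ^ v * h) - 1 = int p ^ (s + v) * y * c \<and> \<not> int p dvd c"
  using s x
proof (induction v arbitrary: x y s)
  case 0
  have "int p dvd x - 1" using 0 by (simp add: dvd_mult2)
  then have "[(\<Sum>i<h. x ^ i) = int h] (mod int p)"
    by (intro sum_powers_cong) (simp add: cong_iff_dvd_diff)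
  then have "\<not> int p dvd (\<Sum>i<h. x ^ i)"
    using h cong_dvd_iff int_dvd_int_iff by blast
  then show ?case
    using 0 power_minus_1_eq[of x h] by (intro exI[of _ "\<Sum>i<h. x ^ i"]) simp
next
  case (Suc v)
  have "int p ^ 2 dvd x - 1" using Suc.prems by (simp add: dvd_mult2 le_imp_power_dvd)
  then have "[(\<Sum>i<p. x ^ i) = int p] (mod int p ^ 2)"
    by (intro sum_powers_cong) (simp add: cong_iff_dvd_diff)
  then obtain k where "(\<Sum>i<p. x ^ i) - int p = int p ^ 2 * k"
    unfolding cong_iff_dvd_diff by (auto elim: dvdE)
  then have gs: "(\<Sum>i<p. x ^ i) = int p * (1 + int p * k)"
    by (simp add: algebra_simps power2_eq_square)
  have "\<not> int p dvd 1 + int p * k"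
    using p by (simp add: dvd_add_left_iff) (metis not_prime_1 One_nat_def)
  have "x ^ p - 1 = int p ^ Suc s * (y * (1 + int p * k))"
    using power_minus_1_eq[of x p] Suc.prems(2) unfolding gs by (simp add: mult_ac)
  from Suc.IH[OF _ this] Suc.prems(1) obtain c where
    c: "(x ^ p) ^ (p ^ v * h) - 1 = int p ^ (Suc s + v) * (y * (1 + int p * k)) * c" "\<not> int p dvd c"
    by auto
  have "\<not> int p dvd (1 + int p * k) * c"
    using c(2) \<open>\<not> int p dvd 1 + int p * k\<close> p by (simp add: prime_dvd_mult_iff)
  moreover have "x ^ (p ^ Suc v * h) = (x ^ p) ^ (p ^ v * h)"
    by (simp add: power_mult[symmetric] mult.assoc)
  then have "x ^ (p ^ Suc v * h) - 1 = int p ^ (s + Suc v) * y * ((1 + int p * k) * c)"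
    using c(1) by (simp only: add_Suc add_Suc_right mult.assoc)
  ultimately show ?case by blast
qed

lemma power_diff_1_lifting_multiplicity:
  fixes x y :: int and p :: nat
  assumes "prime p" "s \<ge> 2" "x - 1 = int p ^ s * y" "h > 0"
  shows "\<exists>c. x ^ h - 1 = int p ^ (s + multiplicity p h) * y * c \<and> \<not> int p dvd c"
proof -
  obtain h' where h': "h = p ^ multiplicity p h * h'" "\<not> p dvd h'"
    using multiplicity_decompose'[of h p] assms not_prime_unit by blast
  then show ?thesis
    using power_diff_1_lifting[OF assms(1-3) h'(2), of "multiplicity p h"] by simp
qed

text \<open>Each prime factor q of \<open>Y\<close> is gained by one q-th power: the cofactor is a
  sum of q terms that are 1 modulo q.\<close>

lemma dvd_power_self_diff_1:
  fixes x :: int and Y :: nat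
  assumes "\<And>q. prime q \<Longrightarrow> q dvd Y \<Longrightarrow> int q dvd x - 1"
  shows "int Y dvd x ^ Y - 1"
  using assms
proof (induction Y rule: prime_divisors_induct)
  case (factor q Y)
  have "int q dvd x ^ Y - 1"
    using factor.prems[of q] factor.hyps power_minus_1_eq[of x Y] by (simp add: dvd_mult2)
  then have "[(\<Sum>i<q. (x ^ Y) ^ i) = int q] (mod int q)"
    by (intro sum_powers_cong) (simp add: cong_iff_dvd_diff)
  then have "int q dvd (\<Sum>i<q. (x ^ Y) ^ i)"
    by (simp add: cong_dvd_iff)
  moreover have "int Y dvd x ^ Y - 1" using factor by auto
  ultimately have "int Y * int q dvd (x ^ Y - 1) * (\<Sum>i<q. (x ^ Y) ^ i)"
    by (rule mult_dvd_mono[rotated])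
  then show ?case
    using power_minus_1_eq[of "x ^ Y" q] by (simp add: power_mult[symmetric] mult_ac)
next
  case zero
  show ?case by simp
next
  case (unit Y)
  then show ?case by simp
qed

section \<open>Additive characters modulo q\<close>

lemma unit_exp_cong:
  fixes x y :: int and q :: nat
  assumes "[x = y] (mod int q)"
  shows "unit_exp (of_int x / real q) = unit_exp (of_int y / real q)"
proof (cases "q = 0")
  case False
  obtain k where "x - y = int q * k"
    using assms unfolding cong_iff_dvd_diff by (elim dvdE)
  then have "x = y + int q * k" by linarith
  then have "of_int x / real q = (of_int y + real q * of_int k) / real q"
    by simp
  also have "\<dots> = of_int y / real q + of_int k"
    using False by (simp add: add_divide_distrib)
  finally show ?thesis by (simp only: unit_exp_add_of_int)
qed simp

lemma unit_exp_eq_1_iff_dvd: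
  assumes "q > 0"
  shows "unit_exp (of_int x / real q) = 1 \<longleftrightarrow> int q dvd x"
proof -
  have "of_int x / real q = (of_int x / of_int (int q) :: real)" by simp
  also have "\<dots> \<in> \<int> \<longleftrightarrow> int q dvd x"
    using assms by (subst of_int_div_of_int_in_Ints_iff) simp
  finally show ?thesis unfolding unit_exp_eq_1_iff .
qed

subsection \<open>Weyl differencing\<close>

text \<open>Modulo \<open>1\<close> the phase is linear in \<open>k\<close>, because \<open>(G - 1)\<^sup>2\<close> times the frequency is an integer.\<close>

lemma weyl_bound_base:
  fixes G Y c \<alpha> :: int and p :: nat
  assumes p: "prime p" and G: "G - 1 = int p ^ s * Y * c" and "\<not> int p dvd c" "\<not> int p dvd \<alpha>"
    and w: "1 \<le> w" "w \<le> s" and Y: "Y \<noteq> 0"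
  shows "norm (\<Sum>k<K. unit_exp (of_int (\<alpha> * G ^ k) / (real p ^ (s + w) * of_int Y))) \<le> real (p ^ w)"
proof -
  define D where "D = real p ^ (s + w) * of_int Y"
  define \<zeta> where "\<zeta> = unit_exp (of_int (\<alpha> * c) / real (p ^ w))"
  have p0: "p > 0" using p prime_gt_0_nat by blast
  have D0: "D \<noteq> 0" using p0 Y by (simp add: D_def)
  have Gs: "[G = 1] (mod int (p ^ w))"
    unfolding cong_iff_dvd_diff of_nat_power G by (intro dvd_mult2 le_imp_power_dvd w)
  \<comment> \<open>Passing from k to k + 1 multiplies the term by e(\<alpha> c G^k / p^w). As w
    \<le> s, G is 1 modulo p^w, so this ratio does not depend on k.\<close>
  have step: "unit_exp (of_int (\<alpha> * G ^ Suc k) / D) = unit_exp (of_int (\<alpha> * G ^ k) / D) * \<zeta>" for k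
  proof -
    have "\<alpha> * G ^ Suc k = \<alpha> * G ^ k + \<alpha> * G ^ k * (int p ^ s * Y * c)"
      unfolding G[symmetric] by (simp only: power_Suc) (simp add: algebra_simps)
    then have "of_int (\<alpha> * G ^ Suc k) / D = of_int (\<alpha> * G ^ k) / D + of_int (\<alpha> * G ^ k * (int p ^ s * Y * c)) / D"
      by (simp only: of_int_add add_divide_distrib)
    also have "of_int (\<alpha> * G ^ k * (int p ^ s * Y * c)) / D = of_int (\<alpha> * c * G ^ k) / real (p ^ w)"
      using p0 Y by (simp add: D_def field_simps power_add)
    finally have "unit_exp (of_int (\<alpha> * G ^ Suc k) / D) =
      unit_exp (of_int (\<alpha> * G ^ k) / D) * unit_exp (of_int (\<alpha> * c * G ^ k) / real (p ^ w))"
      by (simp add: unit_exp_add)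
    also have "unit_exp (of_int (\<alpha> * c * G ^ k) / real (p ^ w)) = \<zeta>"
      unfolding \<zeta>_def
    proof (rule unit_exp_cong)
      have "[\<alpha> * c * G ^ k = \<alpha> * c * 1 ^ k] (mod int (p ^ w))"
        using Gs by (intro cong_mult cong_pow cong_refl)
      then show "[\<alpha> * c * G ^ k = \<alpha> * c] (mod int (p ^ w))" by simp
    qed
    finally show ?thesis .
  qed
  have "unit_exp (of_int (\<alpha> * G ^ k) / D) = unit_exp (of_int \<alpha> / D) * \<zeta> ^ k" for k
  proof (induction k)
    case (Suc k)
    then show ?case unfolding step by simp
  qed simp
  then have "(\<Sum>k<K. unit_exp (of_int (\<alpha> * G ^ k) / D)) = unit_exp (of_int \<alpha> / D) * (\<Sum>k<K. \<zeta> ^ k)"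
    by (simp add: sum_distrib_left)
  then have "norm (\<Sum>k<K. unit_exp (of_int (\<alpha> * G ^ k) / D)) = norm (\<Sum>k<K. \<zeta> ^ k)"
    by (simp add: norm_mult)
  also have "\<dots> \<le> real (p ^ w)"
  proof (rule norm_geometric_sum_root_of_unity)
    have "\<zeta> ^ (p ^ w) = unit_exp (of_int (\<alpha> * c))"
      using p0 by (simp add: \<zeta>_def unit_exp_power)
    then show "\<zeta> ^ (p ^ w) = 1" by (simp only: unit_exp_of_int)
    have "\<not> int p dvd \<alpha> * c" using assms by (simp add: prime_dvd_mult_iff)
    then have "\<not> int (p ^ w) dvd \<alpha> * c"
      using w by (metis dvd_power dvd_trans less_le_trans of_nat_power zero_less_one)
    then show "\<zeta> \<noteq> 1"
      using p0 by (simp only: \<zeta>_def unit_exp_eq_1_iff_dvd zero_less_power) simp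
  qed (use p0 in simp)
  finally show ?thesis by (simp add: D_def)
qed

text \<open>
  \<open>V\<close> is the threshold for the exceptional shifts: those divisible by \<open>p ^ V\<close> are bounded trivially,
  and the others lower the spare exponent \<open>w\<close> by less than \<open>V\<close> each.
\<close>

lemma weyl_bound:
  fixes G Y \<alpha> :: int and p :: nat and \<eta> :: real
  assumes p: "prime p" and Y: "Y \<noteq> 0"
    and lift: "\<And>h. h > 0 \<Longrightarrow> \<exists>c. G ^ h - 1 = int p ^ (s + multiplicity p h) * Y * c \<and> \<not> int p dvd c"
    and \<eta>: "0 < \<eta>" "\<eta> \<le> 1" and V: "1 \<le> V" "1 \<le> \<eta> * real p ^ V"
    and W: "W \<le> s" "real p ^ W \<le> \<eta> * real K"
    and "\<not> int p dvd \<alpha>" "(j + 1) * V \<le> w" "w \<le> W" "K' \<le> K"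
  shows "norm (\<Sum>k<K'. unit_exp (of_int (\<alpha> * G ^ k) / (real p ^ ((j + 1) * s + w) * of_int Y ^ (j + 1))))
    \<le> 5 * real K * \<eta> powr ((1 / 2) ^ j)"
  using assms(10-13)
\<comment> \<open>The differenced sums have varying lengths K' - h, but all are measured against the
  same \<open>K\<close>, so \<open>K\<close>, \<open>W\<close> and \<open>V\<close> stay
  fixed.\<close>
proof (induction j arbitrary: \<alpha> w K')
  case 0
  obtain c where c: "G - 1 = int p ^ s * Y * c" "\<not> int p dvd c"
    using lift[of 1] by auto
  have "norm (\<Sum>k<K'. unit_exp (of_int (\<alpha> * G ^ k) / (real p ^ (s + w) * of_int Y))) \<le> real (p ^ w)"
    using 0 V W by (intro weyl_bound_base[OF p c]) (auto simp: Y)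
  also have "\<dots> \<le> real p ^ W"
    using 0(3) prime_ge_1_nat[OF p] by (simp add: power_increasing)
  also have "\<dots> \<le> \<eta> * real K" by fact
  also have "\<dots> \<le> 5 * real K * \<eta> powr ((1 / 2) ^ 0)" using \<eta> by simp
  finally show ?case by simp
next
  case (Suc j)
  define B where "B = \<eta> powr ((1 / 2) ^ j)"
  define \<theta> where "\<theta> = of_int \<alpha> / (real p ^ ((Suc j + 1) * s + w) * of_int Y ^ (Suc j + 1))"
  define z where "z = (\<lambda>k. unit_exp (\<theta> * of_int (G ^ k)))"
  define T where "T = (\<lambda>h. norm (\<Sum>k<K'-h. z (k + h) * cnj (z k)))"
  have p0: "p > 0" using p prime_gt_0_nat by blast
  have K: "1 \<le> \<eta> * real K"
    using W(2) one_le_power[of "real p" W] p0 by linarith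
  have B: "\<eta> \<le> B" 
    using powr_mono'[of "(1/2)^j" 1 \<eta>] \<eta> by (simp add: B_def power_le_one)
  \<comment> \<open>For a shift that is not exceptional, the factor G^h - 1 cancels p^(s+v) Y from
    the denominator. What remains has the same shape with one factor fewer, w - v for
    \<open>w\<close>, and the numerator \<alpha> c, still prime to p.\<close>
  have main: "T h \<le> 5 * real K * B" if h: "h \<in> {1..<K'}" "\<not> p ^ V dvd h" for h
  proof -
    define v where "v = multiplicity p h"
    obtain c where c: "G ^ h - 1 = int p ^ (s + v) * Y * c" "\<not> int p dvd c"
      using lift[of h] h unfolding v_def by auto
    have v: "v < V" using h(2) unfolding v_def by (metis multiplicity_dvd' not_less)
    then have vw: "v \<le> w" "(j + 1) * V \<le> w - v" using Suc.prems by auto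
    have "z (k + h) * cnj (z k) = unit_exp (of_int ((\<alpha> * c) * G ^ k) /
      (real p ^ ((j + 1) * s + (w - v)) * of_int Y ^ (j + 1)))" for k
    proof -
      have "z (k + h) * cnj (z k) = unit_exp (\<theta> * of_int (G ^ (k + h)) - \<theta> * of_int (G ^ k))"
        using unit_exp_add[of "\<theta> * of_int (G ^ (k + h))" "- (\<theta> * of_int (G ^ k))"]
        by (simp add: z_def cnj_unit_exp)
      also have "\<theta> * of_int (G ^ (k + h)) - \<theta> * of_int (G ^ k) = \<theta> * of_int (G ^ k) * of_int (G ^ h - 1)"
        by (simp add: algebra_simps power_add)
      also have "\<dots> = of_int ((\<alpha> * c) * G ^ k) / (real p ^ ((j + 1) * s + (w - v)) * of_int Y ^ (j + 1))"
      proof -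
        have "real p ^ ((Suc j + 1) * s + w) = real p ^ ((j + 1) * s + (w - v)) * real p ^ (s + v)"
          using vw(1) by (simp add: power_add[symmetric] algebra_simps)
        then show ?thesis
          unfolding c(1) \<theta>_def using p0 Y by (simp add: field_simps)
      qed
      finally show ?thesis .
    qed
    then have "T h = norm (\<Sum>k<K'-h. unit_exp (of_int ((\<alpha> * c) * G ^ k) /
      (real p ^ ((j + 1) * s + (w - v)) * of_int Y ^ (j + 1))))"
      unfolding T_def by simp
    also have "\<dots> \<le> 5 * real K * \<eta> powr ((1 / 2) ^ j)"
      using Suc.prems c(2) p vw by (intro Suc.IH) (auto simp: prime_dvd_mult_iff)
    finally show ?thesis unfolding B_def .
  qed
  have triv: "T h \<le> real K" for h
  proof -
    have "T h \<le> real (card {..<K'-h})"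
      unfolding T_def by (rule norm_sum_le_card) (simp add: z_def norm_mult)
    also have "\<dots> \<le> real K" using Suc.prems by simp
    finally show ?thesis .
  qed
  have "(\<Sum>h\<in>{1..<K'}. T h) \<le> (\<Sum>h\<in>{1..<K'}. 5 * real K * B + (if p ^ V dvd h then real K else 0))"
  proof (rule sum_mono)
    fix h assume "h \<in> {1..<K'}"
    moreover have "0 \<le> real K * B" by (simp add: B_def)
    ultimately show "T h \<le> 5 * real K * B + (if p ^ V dvd h then real K else 0)"
      using main[of h] triv[of h] by (cases "p ^ V dvd h") (simp_all add: mult.assoc)
  qed
  also have "\<dots> = real (K' - 1) * (5 * real K * B) + real (card {h\<in>{1..<K'}. p ^ V dvd h}) * real K"
    by (simp add: sum.distrib sum.If_cases Int_def)
  also have "\<dots> \<le> real K * (5 * real K * B) + real K * \<eta> * real K"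
  proof (intro add_mono mult_right_mono)
    have "real (card {h\<in>{1..<K'}. p ^ V dvd h}) \<le> real K' / real (p ^ V)"
      by (rule card_multiples_le) (use p0 in simp)
    also have "\<dots> \<le> real K / real (p ^ V)"
      using Suc.prems by (simp add: divide_right_mono)
    also have "\<dots> \<le> real K * \<eta>"
    proof -
      have "real K * 1 \<le> real K * (\<eta> * real p ^ V)" using V by (intro mult_left_mono) auto
      then show ?thesis using p0 by (simp add: field_simps)
    qed
    finally show "real (card {h\<in>{1..<K'}. p ^ V dvd h}) \<le> real K * \<eta>" .
  qed (use Suc.prems in \<open>auto simp: B_def\<close>)
  finally have sumT: "(\<Sum>h\<in>{1..<K'}. T h) \<le> 5 * (real K)\<^sup>2 * B + (real K)\<^sup>2 * \<eta>"
    by (simp add: power2_eq_square mult_ac)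
  have "(norm (\<Sum>k<K'. z k))\<^sup>2 \<le> real K' + 2 * (\<Sum>h\<in>{1..<K'}. T h)"
    unfolding T_def by (rule norm_sum_square_le) (simp add: z_def)
  \<comment> \<open>The diagonal is absorbed by \<eta> K \<ge> 1, which follows from p^W \<le>
    \<eta> K.\<close>
  also have "\<dots> \<le> (real K)\<^sup>2 * \<eta> + 2 * (5 * (real K)\<^sup>2 * B + (real K)\<^sup>2 * \<eta>)"
  proof -
    have "real K * 1 \<le> real K * (\<eta> * real K)" using K by (intro mult_left_mono) auto
    then have "real K \<le> (real K)\<^sup>2 * \<eta>" by (simp add: power2_eq_square mult_ac)
    then have "real K' \<le> (real K)\<^sup>2 * \<eta>" using Suc.prems by simp
    then show ?thesis by (intro add_mono mult_left_mono sumT) simp_all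
  qed
  \<comment> \<open>The constant 5 reproduces itself: since \<eta> \<le> B, the bound is at most 13
    K^2 B, below 5^2 K^2 B.\<close>
  also have "\<dots> \<le> 25 * ((real K)\<^sup>2 * B)"
  proof -
    have "(real K)\<^sup>2 * \<eta> \<le> (real K)\<^sup>2 * B" using B by (intro mult_left_mono) auto
    moreover have "0 \<le> (real K)\<^sup>2 * B" by (simp add: B_def)
    moreover have "x + 2 * (5 * y + x) \<le> 25 * y" if "x \<le> y" "0 \<le> y" for x y :: real
      using that by (simp add: algebra_simps)
    ultimately show ?thesis unfolding mult.assoc by blast
  qed
  also have "\<dots> = (5 * real K * \<eta> powr ((1 / 2) ^ Suc j))\<^sup>2"
  proof -
    have "(\<eta> powr ((1 / 2) ^ Suc j))\<^sup>2 = B"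
      unfolding B_def power2_eq_square by (simp add: powr_add[symmetric])
    then show ?thesis by (simp add: power_mult_distrib)
  qed
  finally have "norm (\<Sum>k<K'. z k) \<le> 5 * real K * \<eta> powr ((1 / 2) ^ Suc j)"
    by (rule power2_le_imp_le) simp
  then show ?case by (simp add: z_def \<theta>_def)
qed

text \<open>The inner limit is the ceiling of (N - i)/T; by truncated subtraction it is 0 when N
  \<le> i, so T may exceed N.\<close>

lemma sum_residue_classes:
  fixes f :: "nat \<Rightarrow> 'a :: comm_monoid_add"
  assumes "T > 0"
  shows "(\<Sum>n<N. f n) = (\<Sum>i<T. \<Sum>k<(N - i + T - 1) div T. f (i + T * k))"
proof -
  have *: "k < (N - i + T - 1) div T \<longleftrightarrow> i + T * k < N" for i k
  proof -
    have "k < (N - i + T - 1) div T \<longleftrightarrow> Suc k * T \<le> N - i + T - 1"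
      using less_eq_div_iff_mult_less_eq[OF assms, of "Suc k" "N - i + T - 1"] by (simp add: Suc_le_eq)
    also have "\<dots> \<longleftrightarrow> T * k \<le> N - i - 1 \<and> 0 < N - i"
      using assms by (cases "N - i") (auto simp: mult.commute)
    also have "\<dots> \<longleftrightarrow> i + T * k < N"
      by auto
    finally show ?thesis .
  qed
  have "(\<Sum>i<T. \<Sum>k<(N - i + T - 1) div T. f (i + T * k)) =
    (\<Sum>(i,k)\<in>Sigma {..<T} (\<lambda>i. {..<(N - i + T - 1) div T}). f (i + T * k))"
    by (subst sum.Sigma) auto
  also have "\<dots> = (\<Sum>n<N. f n)"
    by (rule sum.reindex_bij_witness[where j = "\<lambda>(i,k). i + T * k" and i = "\<lambda>n. (n mod T, n div T)"])
       (use assms in \<open>auto simp: * simp del: One_nat_def\<close>)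
  finally show ?thesis ..
qed

subsection \<open>Discrepancy\<close>

text \<open>A crude form of Jordan's inequality: with x \<le> 2 the cubic remainder is at most 2x/3,
  leaving sin x \<ge> x/3.\<close>

lemma sin_ge_quarter:
  assumes "0 \<le> x" "x \<le> pi / 2"
  shows "x / 4 \<le> sin x"
proof -
  have "\<bar>sin x - (\<Sum>m<3. sin_coeff m * x ^ m)\<bar> \<le> inverse (fact 3) * \<bar>x\<bar> ^ 3"
    by (rule Maclaurin_sin_bound)
  then have "\<bar>sin x - x\<bar> \<le> x * x\<^sup>2 / 6"
    using assms by (simp add: eval_nat_numeral sin_coeff_def field_simps)
  moreover have "x \<le> 2" using assms pi_less_4 by linarith
  then have "x\<^sup>2 \<le> 2\<^sup>2" using assms by (intro power_mono) auto
  then have "x * x\<^sup>2 \<le> x * 4" using assms by (intro mult_left_mono) auto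
  ultimately show ?thesis using assms by linarith
qed

text \<open>Taking out e(t/2) shows that the norm is 2 sin(\<pi> t).\<close>

lemma norm_unit_exp_minus_1:
  assumes "0 \<le> t" "t \<le> 1 / 2"
  shows "t \<le> norm (unit_exp t - 1)"
proof -
  have "unit_exp t - 1 = unit_exp (t / 2) * (unit_exp (t / 2) - unit_exp (- (t / 2)))"
    by (simp add: algebra_simps unit_exp_add[symmetric]) (simp add: unit_exp_def)
  then have "norm (unit_exp t - 1) = norm (unit_exp (t / 2) - unit_exp (- (t / 2)))"
    by (simp add: norm_mult)
  also have "unit_exp (t / 2) - unit_exp (- (t / 2)) = complex_of_real (2 * sin (pi * t)) * \<i>"
    by (simp add: unit_exp_def complex_eq_iff)
  also have "norm \<dots> = 2 * sin (pi * t)"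
    using assms sin_ge_zero[of "pi * t"] by (simp add: norm_mult mult_left_le)
  finally have "norm (unit_exp t - 1) = 2 * sin (pi * t)" .
  moreover have "pi * t / 4 \<le> sin (pi * t)"
    using assms by (intro sin_ge_quarter) auto
  moreover have "2 * t \<le> pi * t"
    using assms pi_ge_two by (intro mult_right_mono) auto
  ultimately show ?thesis by linarith
qed

lemma norm_geometric_sum_le:
  assumes "0 < t" "t \<le> 1 / 2"
  shows "norm (\<Sum>i<d. unit_exp (real i * t)) \<le> 2 / t"
proof -
  have t: "t \<le> norm (unit_exp t - 1)" using norm_unit_exp_minus_1 assms by simp
  then have "unit_exp t \<noteq> 1" using assms by auto
  have "(\<Sum>i<d. unit_exp (real i * t)) = (\<Sum>i<d. unit_exp t ^ i)"
    by (simp add: unit_exp_power)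
  also have "\<dots> = (unit_exp t ^ d - 1) / (unit_exp t - 1)"
    using \<open>unit_exp t \<noteq> 1\<close> by (rule geometric_sum)
  finally have "norm (\<Sum>i<d. unit_exp (real i * t)) = norm (unit_exp t ^ d - 1) / norm (unit_exp t - 1)"
    by (simp add: norm_divide)
  also have "\<dots> \<le> 2 / t"
  proof (rule frac_le)
    show "norm (unit_exp t ^ d - 1) \<le> 2"
      using norm_triangle_ineq4[of "unit_exp t ^ d" 1] by (simp add: norm_power)
  qed (use t assms in auto)
  finally show ?thesis .
qed

text \<open>The bound is 2 divided by the distance from h/m to the nearest integer. For h > m/2 the
  sum is the conjugate of the one at m - h.\<close>

lemma norm_residue_sum_le:
  assumes h: "0 < h" "h < m"
  shows "norm (\<Sum>i<d. unit_exp (real i * (real h / real m))) \<le> 2 * real m / real (min h (m - h))"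
proof (cases "2 * h \<le> m")
  case True
  have "norm (\<Sum>i<d. unit_exp (real i * (real h / real m))) \<le> 2 / (real h / real m)"
    using h True by (intro norm_geometric_sum_le) (auto simp: field_simps)
  then show ?thesis using True by (simp add: min_def)
next
  case False
  have *: "unit_exp (real i * (real h / real m)) = cnj (unit_exp (real i * (real (m - h) / real m)))" for i
  proof -
    have "real i * (real h / real m) = - (real i * (real (m - h) / real m)) + of_int (int i)"
      using h by (simp add: of_nat_diff field_simps)
    then show ?thesis by (simp only: unit_exp_add_of_int cnj_unit_exp)
  qed
  have "norm (\<Sum>i<d. unit_exp (real i * (real h / real m))) =
    norm (\<Sum>i<d. unit_exp (real i * (real (m - h) / real m)))"
    unfolding * by (simp flip: cnj_sum)
  also have "\<dots> \<le> 2 / (real (m - h) / real m)"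
    using h False by (intro norm_geometric_sum_le) (auto simp: field_simps)
  finally show ?thesis using False h by (simp add: min_def)
qed

text \<open>Orthogonality of the characters modulo m, used to detect congruences.\<close>

lemma sum_unit_exp_residues:
  fixes x :: int
  assumes "m > 0"
  shows "(\<Sum>h<m. unit_exp (real h * (of_int x / real m))) = (if int m dvd x then of_nat m else 0)"
proof -
  note * = unit_exp_eq_1_iff_dvd[OF assms, of x]
  have **: "(\<Sum>h<m. unit_exp (real h * (of_int x / real m))) = (\<Sum>h<m. unit_exp (of_int x / real m) ^ h)"
    by (simp add: unit_exp_power)
  have "unit_exp (of_int x / real m) ^ m = 1"
    using assms by (simp add: unit_exp_power)
  then show ?thesis
    unfolding ** using * geometric_sum[of "unit_exp (of_int x / real m)" m]
    by (cases "unit_exp (of_int x / real m) = 1") auto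
qed

lemma sum_inverse_squares_tail:
  assumes "H > 0"
  shows "(\<Sum>x\<in>{Suc H..<m}. 1 / (real x)\<^sup>2) \<le> 1 / real H"
proof (cases "m \<le> Suc H")
  case False
  have "(\<Sum>x\<in>{Suc H..<Suc n}. 1 / (real x)\<^sup>2) \<le> 1 / real H - 1 / real n" if "H \<le> n" for n
    using that
  proof (induction n rule: dec_induct)
    case (step n)
    have "1 / (real (Suc n))\<^sup>2 \<le> 1 / real n - 1 / real (Suc n)"
    proof -
      have "1 / (real (Suc n))\<^sup>2 \<le> 1 / (real n * real (Suc n))"
        using step assms by (intro divide_left_mono) (auto simp: power2_eq_square)
      also have "\<dots> = 1 / real n - 1 / real (Suc n)"
        using step assms by (simp add: field_simps)
      finally show ?thesis .
    qed
    then show ?case using step by simp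
  qed simp
  from this[of "m - 1"] False
  have "(\<Sum>x\<in>{Suc H..<m}. 1 / (real x)\<^sup>2) \<le> 1 / real H - 1 / real (m - 1)" by simp
  also have "\<dots> \<le> 1 / real H" by simp
  finally show ?thesis .
qed simp

text \<open>
  The solutions of \<open>y n + j \<equiv> u + i (mod m)\<close> with \<open>j < l\<close> and \<open>i < v - u + l\<close> include all \<open>l\<close> values
  of \<open>j\<close> whenever \<open>y n\<close> lies in the interval. Averaging over \<open>j\<close> makes the Fourier coefficients
  decay quadratically, so the frequencies above \<open>H\<close> can be bounded trivially.
\<close>

lemma count_interval_upper:
  fixes y :: "nat \<Rightarrow> nat"
  assumes m: "m > 0" and uv: "u \<le> v" and l: "l > 0" and H: "H > 0"
    and E: "\<And>h. 1 \<le> h \<Longrightarrow> h \<le> H \<Longrightarrow> norm (\<Sum>n<N. unit_exp (real h * (real (y n) / real m))) \<le> E"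
  shows "real (card {n. n < N \<and> u \<le> y n \<and> y n < v}) \<le>
    real N * (real v - real u + real l) / real m + 4 * real H * E + 8 * real N * real m / (real H * real l)"
proof -
  define w where "w = v - u + l"
  define Y where "Y = (\<lambda>h. \<Sum>n<N. unit_exp (real h * (real (y n) / real m)))"
  define J where "J = (\<lambda>h. \<Sum>j<l. unit_exp (real j * (real h / real m)))"
  define I where "I = (\<lambda>h. \<Sum>i<w. unit_exp (- (real (u + i) * (real h / real m))))"
  \<comment> \<open>Up to H the factors \<open>Y\<close>, \<open>J\<close>, \<open>I\<close> are
    bounded by E, l and 2m; beyond H by N, 2m/x and 2m/x, which is summable.\<close>
  define \<phi> where "\<phi> = (\<lambda>x. if x \<le> H then E * real l * (2 * real m) else real N * (2 * real m)\<^sup>2 * (1 / (real x)\<^sup>2))"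
  define S where "S = {n. n < N \<and> u \<le> y n \<and> y n < v}"
  define Q where "Q = (\<lambda>n i j. int m dvd int (y n) + int j - int (u + i))"
  have E0: "E \<ge> 0" using E[of 1] H norm_ge_zero order_trans by (metis Suc_leI One_nat_def order_refl)
  have \<phi>0: "\<phi> x \<ge> 0" for x using E0 by (simp add: \<phi>_def)
  have J: "norm (J h) \<le> 2 * real m / real (min h (m - h))" if "0 < h" "h < m" for h
    unfolding J_def using that by (rule norm_residue_sum_le)
  have I: "norm (I h) \<le> 2 * real m / real (min h (m - h))" if "0 < h" "h < m" for h
  proof -
    have "I h = unit_exp (- (real u * (real h / real m))) * cnj (\<Sum>i<w. unit_exp (real i * (real h / real m)))"
      by (simp add: I_def sum_distrib_left cnj_unit_exp unit_exp_add[symmetric] algebra_simps add_divide_distrib)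
    then have "norm (I h) = norm (\<Sum>i<w. unit_exp (real i * (real h / real m)))"
      by (simp add: norm_mult del: cnj_sum)
    also have "\<dots> \<le> 2 * real m / real (min h (m - h))"
      using that by (rule norm_residue_sum_le)
    finally show ?thesis .
  qed
  \<comment> \<open>Because \<open>y n\<close> is an integer, h and m - h give conjugate sums; so E
    also controls the frequencies just below m.\<close>
  have Ysym: "norm (Y (m - h)) = norm (Y h)" if "h < m" for h
  proof -
    have "unit_exp (real (m - h) * (real (y n) / real m)) = cnj (unit_exp (real h * (real (y n) / real m)))" for n
    proof -
      have "real (m - h) * (real (y n) / real m) = - (real h * (real (y n) / real m)) + of_int (int (y n))"
        using that by (simp add: of_nat_diff field_simps)
      then show ?thesis by (simp only: unit_exp_add_of_int cnj_unit_exp)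
    qed
    then show ?thesis by (simp add: Y_def flip: cnj_sum)
  qed
  have trm: "norm (Y h * J h * I h) \<le> \<phi> h + \<phi> (m - h)" if h: "0 < h" "h < m" for h
  proof -
    define x where "x = min h (m - h)"
    have x: "0 < x" using h by (simp add: x_def)
    have "norm (Y h * J h * I h) \<le> \<phi> x"
    proof (cases "x \<le> H")
      case True
      have "norm (Y h) = norm (Y x)" using Ysym[of h] h by (simp add: x_def min_def)
      also have "\<dots> \<le> E" unfolding Y_def using True x by (intro E) auto
      finally have "norm (Y h) \<le> E" .
      moreover have "norm (J h) \<le> real l"
        using norm_sum_le_card[of "{..<l}" "\<lambda>j. unit_exp (real j * (real h / real m))"] by (simp add: J_def)
      moreover have "norm (I h) \<le> 2 * real m"
      proof -
        have "2 * real m / real x \<le> 2 * real m / 1" using x by (intro divide_left_mono) auto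
        then show ?thesis using I[OF h] unfolding x_def[symmetric] by simp
      qed
      ultimately have "norm (Y h) * norm (J h) * norm (I h) \<le> E * real l * (2 * real m)"
        using E0 by (intro mult_mono) auto
      then show ?thesis using True by (simp add: \<phi>_def norm_mult)
    next
      case False
      have "norm (Y h) \<le> real N"
        using norm_sum_le_card[of "{..<N}" "\<lambda>n. unit_exp (real h * (real (y n) / real m))"] by (simp add: Y_def)
      then have "norm (Y h) * norm (J h) * norm (I h) \<le> real N * (2 * real m / real x) * (2 * real m / real x)"
        using I[OF h] J[OF h] unfolding x_def[symmetric] by (intro mult_mono) auto
      then show ?thesis using False by (simp add: \<phi>_def norm_mult power2_eq_square mult_ac)
    qed
    also have "\<dots> \<le> \<phi> h + \<phi> (m - h)" using \<phi>0 by (simp add: x_def min_def)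
    finally show ?thesis .
  qed
  have sum\<phi>: "(\<Sum>h\<in>{1..<m}. \<phi> h) \<le> real H * (E * real l * (2 * real m)) + real N * (2 * real m)\<^sup>2 / real H"
  proof -
    \<comment> \<open>Nothing forces H < m. Filling up the range to H adds only nonnegative
      terms.\<close>
    have "(\<Sum>h\<in>{1..<m}. \<phi> h) \<le> (\<Sum>h\<in>{1..H} \<union> {Suc H..<m}. \<phi> h)"
      using \<phi>0 by (intro sum_mono2) auto
    also have "\<dots> = (\<Sum>h\<in>{1..H}. \<phi> h) + (\<Sum>h\<in>{Suc H..<m}. \<phi> h)"
      by (intro sum.union_disjoint) auto
    also have "(\<Sum>h\<in>{1..H}. \<phi> h) = real H * (E * real l * (2 * real m))"
      by (simp add: \<phi>_def)
    also have "(\<Sum>h\<in>{Suc H..<m}. \<phi> h) = real N * (2 * real m)\<^sup>2 * (\<Sum>h\<in>{Suc H..<m}. 1 / (real h)\<^sup>2)"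
      unfolding sum_distrib_left by (intro sum.cong) (auto simp: \<phi>_def)
    also have "\<dots> \<le> real N * (2 * real m)\<^sup>2 * (1 / real H)"
      using H by (intro mult_left_mono sum_inverse_squares_tail) auto
    finally show ?thesis by simp
  qed
  have symm: "(\<Sum>h\<in>{1..<m}. \<phi> (m - h)) = (\<Sum>h\<in>{1..<m}. \<phi> h)"
    by (rule sum.reindex_bij_witness[where i = "\<lambda>h. m - h" and j = "\<lambda>h. m - h"]) auto
  have Qsum: "(\<Sum>h<m. Y h * J h * I h) = of_nat m * (\<Sum>n<N. \<Sum>i<w. \<Sum>j<l. of_bool (Q n i j))"
  proof -
    have "Y h * J h * I h = (\<Sum>n<N. \<Sum>i<w. \<Sum>j<l.
      unit_exp (real h * (of_int (int (y n) + int j - int (u + i)) / real m)))" for h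
    proof -
      have "Y h * J h * I h = (\<Sum>n<N. \<Sum>i<w. \<Sum>j<l. unit_exp (real h * (real (y n) / real m)) *
        unit_exp (real j * (real h / real m)) * unit_exp (- (real (u + i) * (real h / real m))))"
        unfolding Y_def J_def I_def sum_product
        by (simp only: sum_distrib_left sum_distrib_right mult.assoc)
      also have "\<dots> = (\<Sum>n<N. \<Sum>i<w. \<Sum>j<l.
        unit_exp (real h * (of_int (int (y n) + int j - int (u + i)) / real m)))"
        by (intro sum.cong refl) (simp add: unit_exp_add[symmetric] algebra_simps add_divide_distrib diff_divide_distrib)
      finally show ?thesis .
    qed
    then have "(\<Sum>h<m. Y h * J h * I h) = (\<Sum>h<m. \<Sum>n<N. \<Sum>i<w. \<Sum>j<l.
      unit_exp (real h * (of_int (int (y n) + int j - int (u + i)) / real m)))"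
      by (intro sum.cong refl)
    also have "\<dots> = (\<Sum>n<N. \<Sum>h<m. \<Sum>i<w. \<Sum>j<l.
      unit_exp (real h * (of_int (int (y n) + int j - int (u + i)) / real m)))"
      by (rule sum.swap)
    also have "\<dots> = (\<Sum>n<N. \<Sum>i<w. \<Sum>h<m. \<Sum>j<l.
      unit_exp (real h * (of_int (int (y n) + int j - int (u + i)) / real m)))"
      by (rule sum.cong[OF refl sum.swap])
    also have "\<dots> = (\<Sum>n<N. \<Sum>i<w. \<Sum>j<l. \<Sum>h<m.
      unit_exp (real h * (of_int (int (y n) + int j - int (u + i)) / real m)))"
      by (rule sum.cong[OF refl sum.cong[OF refl sum.swap]])
    also have "\<dots> = (\<Sum>n<N. \<Sum>i<w. \<Sum>j<l. of_nat m * of_bool (Q n i j))"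
      unfolding sum_unit_exp_residues[OF m] Q_def by (intro sum.cong refl) simp
    finally show ?thesis by (simp only: sum_distrib_left)
  qed
  have "real (card S) * real l \<le> (\<Sum>n<N. \<Sum>i<w. \<Sum>j<l. (of_bool (Q n i j) :: real))"
  proof -
    have "real (card S) * real l = (\<Sum>n\<in>S. real l)" by simp
    also have "\<dots> \<le> (\<Sum>n\<in>S. \<Sum>i<w. \<Sum>j<l. (of_bool (Q n i j) :: real))"
    proof (rule sum_mono)
      fix n assume n: "n \<in> S"
      have "real l = (\<Sum>j<l. 1)" by simp
      also have "\<dots> \<le> (\<Sum>j<l. \<Sum>i<w. (of_bool (Q n i j) :: real))"
      proof (rule sum_mono)
        fix j assume j: "j \<in> {..<l}"
        define i where "i = y n + j - u"
        have i: "i < w" "Q n i j" using n j by (auto simp: i_def w_def S_def Q_def)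
        then have "(1 :: real) = (of_bool (Q n i j) :: real)" by simp
        also have "\<dots> \<le> (\<Sum>i<w. (of_bool (Q n i j) :: real))"
          using i by (intro member_le_sum) auto
        finally show "(1 :: real) \<le> (\<Sum>i<w. (of_bool (Q n i j) :: real))" .
      qed
      also have "\<dots> = (\<Sum>i<w. \<Sum>j<l. (of_bool (Q n i j) :: real))" by (rule sum.swap)
      finally show "real l \<le> (\<Sum>i<w. \<Sum>j<l. (of_bool (Q n i j) :: real))" .
    qed
    also have "\<dots> \<le> (\<Sum>n<N. \<Sum>i<w. \<Sum>j<l. (of_bool (Q n i j) :: real))"
      by (intro sum_mono2) (auto simp: S_def intro!: sum_nonneg)
    finally show ?thesis .
  qed
  then have "real m * (real (card S) * real l) \<le> real m * (\<Sum>n<N. \<Sum>i<w. \<Sum>j<l. (of_bool (Q n i j) :: real))"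
    by (intro mult_left_mono) auto
  also have "\<dots> = norm (complex_of_real (real m * (\<Sum>n<N. \<Sum>i<w. \<Sum>j<l. (of_bool (Q n i j) :: real))))"
    by (simp only: norm_of_real) (simp add: sum_nonneg)
  also have "complex_of_real (real m * (\<Sum>n<N. \<Sum>i<w. \<Sum>j<l. (of_bool (Q n i j) :: real))) = (\<Sum>h<m. Y h * J h * I h)"
    unfolding Qsum by simp
  \<comment> \<open>Frequency 0 gives N l w, which becomes N w / m after division by m l; all other
    frequencies are error.\<close>
  also have "\<dots> = Y 0 * J 0 * I 0 + (\<Sum>h\<in>{1..<m}. Y h * J h * I h)"
    using m by (simp add: lessThan_atLeast0 sum.atLeast_Suc_lessThan)
  finally have "real m * (real (card S) * real l) \<le> norm (Y 0 * J 0 * I 0 + (\<Sum>h\<in>{1..<m}. Y h * J h * I h))" .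
  moreover have "norm (Y 0 * J 0 * I 0 + (\<Sum>h\<in>{1..<m}. Y h * J h * I h)) \<le>
    norm (Y 0 * J 0 * I 0) + (\<Sum>h\<in>{1..<m}. \<phi> h + \<phi> (m - h))"
    by (intro norm_triangle_le add_left_mono order_refl sum_norm_le) (auto intro: trm)
  moreover have "(\<Sum>h\<in>{1..<m}. \<phi> h + \<phi> (m - h)) = 2 * (\<Sum>h\<in>{1..<m}. \<phi> h)"
    unfolding sum.distrib symm by simp
  moreover have "norm (Y 0 * J 0 * I 0) = real N * real l * real w"
    by (simp add: Y_def J_def I_def norm_mult unit_exp_def)
  ultimately have "real m * (real (card S) * real l) \<le> real N * real l * real w + 2 * (\<Sum>h\<in>{1..<m}. \<phi> h)"
    by simp
  also have "\<dots> \<le> real N * real l * real w +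
    2 * (real H * (E * real l * (2 * real m)) + real N * (2 * real m)\<^sup>2 / real H)"
    by (intro add_left_mono mult_left_mono sum\<phi>) simp
  finally have "real (card S) \<le>
    (real N * real l * real w + 2 * (real H * (E * real l * (2 * real m)) + real N * (2 * real m)\<^sup>2 / real H)) / (real m * real l)"
    using m l by (simp add: le_divide_eq mult_ac)
  also have "\<dots> = real N * real w / real m + 4 * real H * E + 8 * real N * real m / (real H * real l)"
    using m l H by (simp add: field_simps power2_eq_square)
  finally have "real (card S) \<le> real N * real w / real m + 4 * real H * E + 8 * real N * real m / (real H * real l)" .
  moreover have "real w = real v - real u + real l" using uv by (simp add: w_def of_nat_diff)
  ultimately show ?thesis unfolding S_def by simp
qed

text \<open>The lower bound comes from the upper bounds for the complementary intervals [0,u) and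
  [v,m), since the three counts add up to N. The factor 2 stems from these two errors.\<close>

lemma count_interval_discrepancy:
  fixes y :: "nat \<Rightarrow> nat"
  assumes m: "m > 0" and uv: "u \<le> v" "v \<le> m" and l: "l > 0" and H: "H > 0"
    and y: "\<And>n. y n < m"
    and E: "\<And>h. 1 \<le> h \<Longrightarrow> h \<le> H \<Longrightarrow> norm (\<Sum>n<N. unit_exp (real h * (real (y n) / real m))) \<le> E"
  shows "\<bar>real (card {n. n < N \<and> u \<le> y n \<and> y n < v}) - real N * (real v - real u) / real m\<bar> \<le>
    2 * (real N * real l / real m + 4 * real H * E + 8 * real N * real m / (real H * real l))"
proof -
  define R where "R = real N * real l / real m + 4 * real H * E + 8 * real N * real m / (real H * real l)"
  define c where "c = (\<lambda>u v. real (card {n. n < N \<and> u \<le> y n \<and> y n < v}))"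
  have up: "c u v \<le> real N * (real v - real u) / real m + R" if "u \<le> v" for u v
    using count_interval_upper[OF m that l H E] unfolding c_def R_def
    by (simp add: ring_distribs add_divide_distrib)
  define S1 S2 S3 where "S1 = {n. n < N \<and> 0 \<le> y n \<and> y n < u}"
    and "S2 = {n. n < N \<and> u \<le> y n \<and> y n < v}" and "S3 = {n. n < N \<and> v \<le> y n \<and> y n < m}"
  have "{..<N} = S1 \<union> S2 \<union> S3"
    using uv y by (auto simp: S1_def S2_def S3_def not_less)
  also have "card (S1 \<union> S2 \<union> S3) = card (S1 \<union> S2) + card S3"
    using uv by (intro card_Un_disjoint) (auto simp: S1_def S2_def S3_def)
  also have "card (S1 \<union> S2) = card S1 + card S2"
    using uv by (intro card_Un_disjoint) (auto simp: S1_def S2_def)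
  finally have "real N = c 0 u + c u v + c v m" by (simp add: c_def S1_def S2_def S3_def)
  moreover have "real N = real N * (real u - real 0) / real m + real N * (real v - real u) / real m
    + real N * (real m - real v) / real m"
    using m by (simp add: field_simps)
  moreover have "c 0 u \<ge> 0" "c v m \<ge> 0" "c u v \<ge> 0" by (simp_all add: c_def)
  moreover have "0 \<le> R"
    using up[of 0 0] by (simp add: c_def)
  ultimately have "\<bar>c u v - real N * (real v - real u) / real m\<bar> \<le> 2 * R"
    using up[of 0 u] up[of u v] up[of v m] uv by linarith
  then show ?thesis unfolding c_def R_def .
qed

subsection \<open>Digit strings and intervals\<close>

definition string_value :: "nat \<Rightarrow> nat list \<Rightarrow> nat" where
  "string_value b s = foldl (\<lambda>A d. A * b + d) 0 s"

lemma string_value_simps [simp]: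
  "string_value b [] = 0"
  "string_value b (s @ [d]) = string_value b s * b + d"
  by (simp_all add: string_value_def)

lemma string_value_less:
  assumes "base_string b s"
  shows "string_value b s < b ^ length s"
  using assms
proof (induction s rule: rev_induct)
  case (snoc d s)
  then have "string_value b s < b ^ length s" "d < b" by (auto simp: base_string_def)
  then have "(string_value b s + 1) * b \<le> b ^ length s * b" by (intro mult_right_mono) auto
  with \<open>d < b\<close> show ?case by (simp add: algebra_simps)
qed simp

text \<open>Dividing the floor of y b^(k+1) / m by b gives the floor of y b^k / m, with the newest
  digit as remainder; so the digits can be collected one at a time.\<close>

lemma digits_eq_iff_div:
  fixes y m b :: nat
  assumes "m > 0" "y < m" "base_string b s"
  shows "(\<forall>i. 1 \<le> i \<and> i \<le> length s \<longrightarrow> (y * b ^ i div m) mod b = s ! (i - 1)) \<longleftrightarrow>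
    y * b ^ length s div m = string_value b s"
  using assms(3)
proof (induction s rule: rev_induct)
  case (snoc d s)
  define q where "q = y * b ^ length (s @ [d]) div m"
  have d: "d < b" "base_string b s" using snoc.prems by (auto simp: base_string_def)
  have "(\<forall>i. 1 \<le> i \<and> i \<le> length (s @ [d]) \<longrightarrow> (y * b ^ i div m) mod b = (s @ [d]) ! (i - 1)) \<longleftrightarrow>
    (\<forall>i. 1 \<le> i \<and> i \<le> length s \<longrightarrow> (y * b ^ i div m) mod b = s ! (i - 1)) \<and> q mod b = d"
    (is "?L \<longleftrightarrow> ?R")
  proof -
    have *: "(s @ [d]) ! (i - 1) = s ! (i - 1)" if "1 \<le> i" "i \<le> length s" for i
    proof -
      have "i - 1 < length s" using that by linarith
      then show ?thesis by (simp only: nth_append if_True)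
    qed
    have **: "(1 \<le> i \<and> i \<le> length (s @ [d])) \<longleftrightarrow> (1 \<le> i \<and> i \<le> length s) \<or> i = length (s @ [d])" for i
      by auto
    have ***: "(s @ [d]) ! (length (s @ [d]) - 1) = d" by simp
    show ?thesis unfolding ** q_def using * *** by metis
  qed
  also have "\<dots> \<longleftrightarrow> q div b = string_value b s \<and> q mod b = d"
  proof -
    have "q div b = y * b ^ length s * b div (m * b)"
      by (simp add: q_def div_mult2_eq[symmetric] mult_ac)
    also have "\<dots> = y * b ^ length s div m" using d by (simp add: div_mult_mult2)
    finally show ?thesis using snoc.IH[OF d(2)] by simp
  qed
  also have "\<dots> \<longleftrightarrow> q = string_value b (s @ [d])"
  proof
    assume "q div b = string_value b s \<and> q mod b = d"
    then show "q = string_value b (s @ [d])" using div_mult_mod_eq[of q b] by simp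
  qed (use d(1) in simp)
  finally show ?case unfolding q_def .
qed (use assms in auto)

lemma base_digit_fraction:
  assumes "m > 0"
  shows "base_digit b (real a / real m) i = (a * b ^ i div m) mod b"
proof -
  have "\<lfloor>real a / real m * real b ^ i\<rfloor> = \<lfloor>real (a * b ^ i) / real m\<rfloor>" by simp
  also have "\<dots> = int (a * b ^ i div m)" by (rule floor_divide_of_nat_eq)
  finally show ?thesis by (simp add: base_digit_def flip: of_nat_mod)
qed

text \<open>Multiplication by b^n shifts the expansion. The integer part split off contributes z
  b^i, a multiple of b because i \<ge> 1.\<close>

lemma base_digit_fraction_shift:
  assumes "m > 0" "i \<ge> 1"
  shows "base_digit b (real a / real m) (n + i) = ((a * b ^ n mod m) * b ^ i div m) mod b"
proof -
  define z where "z = a * b ^ n div m"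
  define y where "y = a * b ^ n mod m"
  have "a * b ^ (n + i) = (m * z + y) * b ^ i"
    unfolding z_def y_def by (simp add: power_add)
  also have "\<dots> = y * b ^ i + z * b ^ i * m" by (simp add: algebra_simps)
  finally have "a * b ^ (n + i) div m = z * b ^ i + y * b ^ i div m"
    using assms by simp
  moreover have "b dvd z * b ^ i" using assms by (simp add: dvd_mult dvd_power)
  then obtain t where "z * b ^ i = b * t" by (elim dvdE)
  ultimately show ?thesis
    unfolding base_digit_fraction[OF assms(1)] y_def by simp
qed

lemma string_count_eq_interval_count:
  assumes m: "m > 0" and b: "b > 0" and s: "base_string b s"
  shows "\<exists>u v. u \<le> v \<and> v \<le> m \<and> \<bar>(real v - real u) - real m / real b ^ length s\<bar> \<le> 1 \<and>
    string_count b a m s N = card {n. n < N \<and> u \<le> a * b ^ n mod m \<and> a * b ^ n mod m < v}"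
proof -
  define A where "A = string_value b s"
  define k where "k = length s"
  \<comment> \<open>The condition on y is A m \<le> y b^k < (A + 1) m. Rounding both ends up keeps
    the integers y in the interval exactly and changes its length by at most 1.\<close>
  define u where "u = nat \<lceil>real (A * m) / real b ^ k\<rceil>"
  define v where "v = nat \<lceil>real ((A + 1) * m) / real b ^ k\<rceil>"
  have bk: "real b ^ k > 0" using b by simp
  have ceil: "nat \<lceil>real c / real b ^ k\<rceil> \<le> y \<longleftrightarrow> c \<le> y * b ^ k" for c y
  proof -
    have "nat \<lceil>real c / real b ^ k\<rceil> \<le> y \<longleftrightarrow> real c \<le> real y * real b ^ k"
      unfolding nat_ceiling_le_eq using bk by (rule pos_divide_le_eq)
    also have "\<dots> \<longleftrightarrow> c \<le> y * b ^ k"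
      unfolding of_nat_power[symmetric] of_nat_mult[symmetric] of_nat_le_iff ..
    finally show ?thesis .
  qed
  have *: "y * b ^ k div m = A \<longleftrightarrow> u \<le> y \<and> y < v" for y
  proof -
    have "y * b ^ k div m = A \<longleftrightarrow> A * m \<le> y * b ^ k \<and> \<not> (A + 1) * m \<le> y * b ^ k"
      using m less_eq_div_iff_mult_less_eq[OF m, of A "y * b ^ k"] less_eq_div_iff_mult_less_eq[OF m, of "A + 1" "y * b ^ k"]
      by auto
    also have "\<dots> \<longleftrightarrow> u \<le> y \<and> \<not> v \<le> y"
      unfolding u_def v_def ceil ..
    finally show ?thesis by auto
  qed
  \<comment> \<open>Places are numbered from 1 and exponents of b from 0, hence the successor
    map.\<close>
  have "string_count b a m s N = card (Suc ` {n. n < N \<and> u \<le> a * b ^ n mod m \<and> a * b ^ n mod m < v})"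
  proof -
    have "{n. 1 \<le> n \<and> n \<le> N \<and> (\<forall>i. 1 \<le> i \<and> i \<le> length s \<longrightarrow>
        base_digit b (real a / real m) (n - 1 + i) = s ! (i - 1))} =
      Suc ` {n. n < N \<and> (\<forall>i. 1 \<le> i \<and> i \<le> length s \<longrightarrow>
        base_digit b (real a / real m) (n + i) = s ! (i - 1))}" (is "?X = ?Y")
    proof
      show "?X \<subseteq> ?Y"
      proof
        fix n assume "n \<in> ?X"
        then show "n \<in> ?Y" by (intro image_eqI[of _ _ "n - 1"]) auto
      qed
      show "?Y \<subseteq> ?X"
      proof
        fix n assume "n \<in> ?Y"
        then obtain n' where "n = Suc n'" "n' < N" "\<forall>i. 1 \<le> i \<and> i \<le> length s \<longrightarrow>
          base_digit b (real a / real m) (n' + i) = s ! (i - 1)" by (elim imageE CollectE conjE)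
        then show "n \<in> ?X" by simp
      qed
    qed
    also have "{n. n < N \<and> (\<forall>i. 1 \<le> i \<and> i \<le> length s \<longrightarrow>
        base_digit b (real a / real m) (n + i) = s ! (i - 1))} =
      {n. n < N \<and> u \<le> a * b ^ n mod m \<and> a * b ^ n mod m < v}"
    proof (intro Collect_cong conj_cong refl)
      fix n
      have "(\<forall>i. 1 \<le> i \<and> i \<le> length s \<longrightarrow> base_digit b (real a / real m) (n + i) = s ! (i - 1)) \<longleftrightarrow>
        (\<forall>i. 1 \<le> i \<and> i \<le> length s \<longrightarrow> ((a * b ^ n mod m) * b ^ i div m) mod b = s ! (i - 1))"
        using base_digit_fraction_shift[OF m] by metis
      also have "\<dots> \<longleftrightarrow> (a * b ^ n mod m) * b ^ k div m = A"
        unfolding A_def k_def using m s by (intro digits_eq_iff_div) auto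
      also have "\<dots> \<longleftrightarrow> u \<le> a * b ^ n mod m \<and> a * b ^ n mod m < v" by (rule *)
      finally show "(\<forall>i. 1 \<le> i \<and> i \<le> length s \<longrightarrow> base_digit b (real a / real m) (n + i) = s ! (i - 1)) \<longleftrightarrow>
        u \<le> a * b ^ n mod m \<and> a * b ^ n mod m < v" .
    qed
    finally show ?thesis unfolding string_count_def by simp
  qed
  then have "string_count b a m s N = card {n. n < N \<and> u \<le> a * b ^ n mod m \<and> a * b ^ n mod m < v}"
    by (simp add: card_image)
  moreover have "u \<le> v"
    unfolding u_def v_def using bk by (intro nat_mono ceiling_mono divide_right_mono) auto
  moreover have "v \<le> m"
  proof -
    have "A + 1 \<le> b ^ k" using string_value_less[OF s] by (simp add: A_def k_def)
    then have "(A + 1) * m \<le> b ^ k * m" by (intro mult_right_mono) auto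
    then have "real ((A + 1) * m) \<le> real b ^ k * real m" by (metis of_nat_le_iff of_nat_mult of_nat_power)
    then show ?thesis unfolding v_def nat_ceiling_le_eq using bk by (simp add: divide_le_eq mult.commute)
  qed
  moreover have "\<bar>(real v - real u) - real m / real b ^ k\<bar> \<le> 1"
  proof -
    define x where "x = real (A * m) / real b ^ k"
    have "real ((A + 1) * m) / real b ^ k = x + real m / real b ^ k"
      by (simp add: x_def add_divide_distrib ring_distribs)
    then have v: "v = nat \<lceil>x + real m / real b ^ k\<rceil>" unfolding v_def by simp
    have "0 \<le> x" "0 \<le> real m / real b ^ k" by (simp_all add: x_def)
    then have "real u = of_int \<lceil>x\<rceil>" "real v = of_int \<lceil>x + real m / real b ^ k\<rceil>"
      unfolding v u_def x_def[symmetric] by simp_all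
    then show ?thesis by linarith
  qed
  ultimately show ?thesis unfolding k_def by blast
qed

subsection \<open>Denominators with a fixed set of prime factors\<close>

text \<open>On the class of i modulo T the phase has numerator \<alpha> b^i G^k with G = b^T, and
  \<alpha> b^i is still prime to p. Every class has at most K = N div T + 1 terms, and T K \<le> 2 N
  turns the constant 5 into 10.\<close>

lemma exponential_sum_bound:
  fixes b p Y T :: nat and \<alpha> :: int and \<eta> :: real
  assumes p: "prime p" "\<not> p dvd b" and Y: "Y > 0" and T: "T > 0"
    and lift: "\<And>h. h > 0 \<Longrightarrow> \<exists>c. (int b ^ T) ^ h - 1 = int p ^ (s + multiplicity p h) * int Y * c \<and> \<not> int p dvd c"
    and \<eta>: "0 < \<eta>" "\<eta> \<le> 1" and V: "1 \<le> V" "1 \<le> \<eta> * real p ^ V"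
    and W: "W \<le> s" "real p ^ W * real T \<le> \<eta> * real N"
    and \<alpha>: "\<not> int p dvd \<alpha>" and w: "(j + 1) * V \<le> w" "w \<le> W"
  shows "norm (\<Sum>n<N. unit_exp (of_int (\<alpha> * int b ^ n) / (real p ^ ((j + 1) * s + w) * real Y ^ (j + 1))))
    \<le> 10 * real N * \<eta> powr ((1 / 2) ^ j)"
proof -
  define K where "K = N div T + 1"
  define B where "B = \<eta> powr ((1 / 2) ^ j)"
  define D where "D = real p ^ ((j + 1) * s + w) * real Y ^ (j + 1)"
  define F where "F = (\<lambda>n. unit_exp (of_int (\<alpha> * int b ^ n) / D))"
  have p0: "real p \<ge> 1" using prime_ge_1_nat[OF p(1)] by simp
  have TN: "real T \<le> real N"
  proof -
    have "1 * real T \<le> real p ^ W * real T" using p0 by (intro mult_right_mono one_le_power) auto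
    also have "\<dots> \<le> \<eta> * real N" by fact
    also have "\<dots> \<le> 1 * real N" using \<eta> by (intro mult_right_mono) auto
    finally show ?thesis by simp
  qed
  have KT: "real N \<le> real T * real K" "real T * real K \<le> 2 * real N"
  proof -
    have "N < T * K" using dividend_less_times_div[OF T, of N] by (simp add: K_def algebra_simps)
    then show "real N \<le> real T * real K" by (simp flip: of_nat_mult)
    have "T * K \<le> N + T" by (simp add: K_def algebra_simps)
    then show "real T * real K \<le> 2 * real N" using TN by (simp flip: of_nat_mult)
  qed
  have "real p ^ W * real T \<le> \<eta> * real K * real T"
  proof -
    have "\<eta> * real N \<le> \<eta> * (real T * real K)" using KT \<eta> by (intro mult_left_mono) auto
    then show ?thesis using W(2) by (simp add: mult_ac)
  qed
  then have WK: "real p ^ W \<le> \<eta> * real K" using T by simp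
  have inner: "norm (\<Sum>k<(N - i + T - 1) div T. F (i + T * k)) \<le> 5 * real K * B" if "i < T" for i
  proof -
    have "(N - i + T - 1) div T \<le> (N + T) div T" by (intro div_le_mono) auto
    then have K': "(N - i + T - 1) div T \<le> K" using T by (simp add: K_def)
    have "F (i + T * k) = unit_exp (of_int ((\<alpha> * int b ^ i) * (int b ^ T) ^ k) /
      (real p ^ ((j + 1) * s + w) * of_int (int Y) ^ (j + 1)))" for k
      by (simp add: F_def D_def power_add power_mult mult_ac)
    then have "norm (\<Sum>k<(N - i + T - 1) div T. F (i + T * k)) =
      norm (\<Sum>k<(N - i + T - 1) div T. unit_exp (of_int ((\<alpha> * int b ^ i) * (int b ^ T) ^ k) /
      (real p ^ ((j + 1) * s + w) * of_int (int Y) ^ (j + 1))))" by simp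
    also have "\<dots> \<le> 5 * real K * \<eta> powr ((1 / 2) ^ j)"
    proof (rule weyl_bound)
      show "\<not> int p dvd \<alpha> * int b ^ i"
      proof
        assume "int p dvd \<alpha> * int b ^ i"
        then have "int p dvd int (b ^ i)" using \<alpha> p(1) by (simp add: prime_dvd_mult_iff)
        then have "p dvd b ^ i" by (simp only: int_dvd_int_iff)
        then show False using p prime_dvd_power by blast
      qed
      show "(j + 1) * V \<le> w" by (rule w)
    qed (use assms WK K' in auto)
    finally show ?thesis unfolding B_def .
  qed
  have "norm (\<Sum>n<N. F n) = norm (\<Sum>i<T. \<Sum>k<(N - i + T - 1) div T. F (i + T * k))"
    unfolding sum_residue_classes[OF T, of F N] ..
  also have "\<dots> \<le> (\<Sum>i<T. 5 * real K * B)"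
    by (rule sum_norm_le) (use inner in auto)
  also have "\<dots> = (real T * real K) * (5 * B)" by simp
  also have "\<dots> \<le> (2 * real N) * (5 * B)" by (intro mult_right_mono KT) (simp add: B_def)
  finally show ?thesis by (simp add: F_def D_def B_def)
qed

section \<open>Factorisations supported on a finite set of primes\<close>

lemma integers_over_prod:
  assumes "finite P" "\<forall>p\<in>P. prime p" "n \<in> integers_over P"
  shows "n = (\<Prod>p\<in>P. p ^ multiplicity p n)"
proof -
  have n: "n > 0" and *: "\<And>p. prime p \<Longrightarrow> p dvd n \<Longrightarrow> p \<in> P"
    using assms(3) by (auto simp: integers_over_def)
  have "n = (\<Prod>p\<in>prime_factors n. p ^ multiplicity p n)"
    using n by (rule prime_factorization_nat)
  also have "\<dots> = (\<Prod>p\<in>P. p ^ multiplicity p n)"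
  proof (rule prod.mono_neutral_left)
    show "prime_factors n \<subseteq> P" using * by (auto simp: in_prime_factors_iff)
    show "\<forall>p\<in>P - prime_factors n. p ^ multiplicity p n = 1"
      using assms(2) n by (auto simp: in_prime_factors_iff not_dvd_imp_multiplicity_0)
  qed (use assms in auto)
  finally show ?thesis .
qed

text \<open>Every exponent is raised to a multiple of r, at a cost of at most r for each prime of P;
  this gives an approximate r-th root from above whatever the shape of n.\<close>

lemma integers_over_approx_root:
  assumes P: "finite P" "\<forall>p\<in>P. prime p" and n: "n \<in> integers_over P" and r: "r > 0"
  shows "\<exists>Y>0. (\<forall>q. prime q \<and> q dvd Y \<longrightarrow> q \<in> P) \<and> n dvd Y ^ r \<and> Y ^ r \<le> n * (\<Prod>P) ^ r"
proof -
  define Y where "Y = (\<Prod>p\<in>P. p ^ (multiplicity p n div r + 1))"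
  have n_eq: "n = (\<Prod>p\<in>P. p ^ multiplicity p n)" by (rule integers_over_prod[OF P n])
  have Yr: "Y ^ r = (\<Prod>p\<in>P. p ^ ((multiplicity p n div r + 1) * r))"
    by (simp only: Y_def prod_power_distrib power_mult)
  have le: "multiplicity p n \<le> (multiplicity p n div r + 1) * r"
    "(multiplicity p n div r + 1) * r \<le> multiplicity p n + r" for p
    using dividend_less_div_times[OF r, of "multiplicity p n"] by (auto simp: algebra_simps)
  have "Y > 0" using P prime_gt_0_nat by (auto simp: Y_def intro!: prod_pos)
  moreover have "q \<in> P" if q: "prime q" "q dvd Y" for q
  proof -
    obtain p where p: "p \<in> P" "q dvd p ^ (multiplicity p n div r + 1)"
      using q(2) prime_dvd_prod_iff[OF P(1) q(1), of "\<lambda>p. p ^ (multiplicity p n div r + 1)"]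
      unfolding Y_def by blast
    then have "q dvd p" using q(1) prime_dvd_power by blast
    then show ?thesis using q(1) p(1) P(2) primes_dvd_imp_eq by metis
  qed
  moreover have "n dvd Y ^ r"
    unfolding Yr by (subst n_eq, intro prod_dvd_prod le_imp_power_dvd le)
  moreover have "Y ^ r \<le> n * (\<Prod>P) ^ r"
  proof -
    have "Y ^ r \<le> (\<Prod>p\<in>P. p ^ (multiplicity p n + r))"
      unfolding Yr
    proof (rule prod_mono)
      fix p assume "p \<in> P"
      then have "1 \<le> p" using P(2) prime_ge_1_nat by blast
      then show "0 \<le> p ^ ((multiplicity p n div r + 1) * r) \<and>
        p ^ ((multiplicity p n div r + 1) * r) \<le> p ^ (multiplicity p n + r)"
        using le(2) by (simp add: power_increasing del: add_mult_distrib)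
    qed
    also have "\<dots> = n * (\<Prod>P) ^ r"
      by (subst (2) n_eq) (simp add: power_add prod.distrib prod_power_distrib)
    finally show ?thesis .
  qed
  ultimately show ?thesis by blast
qed

text \<open>The largest of the \<open>card P\<close> prime power factors is taken. It makes the
  exponent of one prime at least of order log n.\<close>

lemma integers_over_dominant_prime:
  assumes P: "finite P" "\<forall>p\<in>P. prime p" and n: "n \<in> integers_over P" "n > 1"
  shows "\<exists>p\<in>P. n \<le> (p ^ multiplicity p n) ^ card P"
proof -
  have "P \<noteq> {}" using integers_over_prod[OF P n(1)] n(2) by auto
  define f where "f = (\<lambda>p. p ^ multiplicity p n)"
  have fin: "finite (f ` P)" "f ` P \<noteq> {}" using P \<open>P \<noteq> {}\<close> by auto
  then obtain p where p: "p \<in> P" "Max (f ` P) = f p" using Max_in by blast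
  have "n = (\<Prod>q\<in>P. f q)" unfolding f_def by (rule integers_over_prod[OF P n(1)])
  also have "\<dots> \<le> (\<Prod>q\<in>P. f p)"
    using p(2) fin Max_ge[OF fin(1)] by (intro prod_mono) auto
  also have "\<dots> = f p ^ card P" by simp
  finally show ?thesis using p(1) unfolding f_def by blast
qed

lemma multiplicity_power_le:
  fixes p h :: nat
  assumes "prime p" "h > 0" "h \<le> 2 ^ V"
  shows "multiplicity p h \<le> V"
proof -
  have "2 ^ multiplicity p h \<le> p ^ multiplicity p h"
    using prime_ge_2_nat[OF assms(1)] by (intro power_mono) auto
  also have "\<dots> \<le> h" using assms(2) by (intro dvd_imp_le multiplicity_dvd) auto
  also have "\<dots> \<le> 2 ^ V" by fact
  finally show ?thesis by simp
qed

text \<open>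
  With \<open>r = j + 1\<close> and \<open>w0 = (r + 1) V\<close>, the exponent of \<open>p\<close> in \<open>m\<close> is \<open>r s + w\<close> with
  \<open>w0 \<le> w \<le> w0 + r\<close>; the extra \<open>V\<close> in \<open>w0\<close> absorbs the power of \<open>p\<close> dividing \<open>h\<close>.
\<close>

lemma exponential_sum_bound_integers_over:
  fixes b m a h r V N T0 :: nat and \<eta> :: real
  assumes P: "finite P" "\<forall>p\<in>P. prime p" and b: "b \<ge> 2" "\<forall>p\<in>P. coprime b p"
    and T0: "T0 > 0" "[b ^ T0 = 1] (mod (\<Prod>P)\<^sup>2)"
    and m: "m \<in> integers_over P" "m > 1" and a: "coprime a m"
    and h: "h > 0" "h \<le> 2 ^ V" and V: "1 \<le> V"
    and \<eta>: "0 < \<eta>" "\<eta> \<le> 1" "1 \<le> \<eta> * 2 ^ V"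
    and size: "real (card P) * real (\<Prod>P) * real ((j + 2) * V + (j + 1) * b ^ T0 + (j + 1) * ((j + 2) * V + (j + 1))) \<le> ln (real m)"
    and N: "real (\<Prod>P) ^ ((j + 2) * V + (j + 1)) * (real T0 * real (\<Prod>P) * real m powr (1 / real (j + 1))) \<le> \<eta> * real N"
  shows "norm (\<Sum>n<N. unit_exp (real h * (real (a * b ^ n) / real m))) \<le> 10 * real N * \<eta> powr ((1 / 2) ^ j)"
proof -
  define R where "R = \<Prod>P"
  define r where "r = j + 1"
  define w0 where "w0 = (j + 2) * V"
  define W where "W = w0 + r"
  have r: "r > 0" by (simp add: r_def)
  obtain p where pP: "p \<in> P" and pm: "m \<le> (p ^ multiplicity p m) ^ card P"
    using integers_over_dominant_prime[OF P m] by blast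
  have p: "prime p" using P pP by blast
  have p0: "p > 0" using p prime_gt_0_nat by blast
  have pR: "p dvd R" unfolding R_def using P(1) pP by (rule dvd_prodI)
  have R0: "R > 0" unfolding R_def using P prime_gt_0_nat by (auto intro!: prod_pos)
  have pleR: "p \<le> R" using pR R0 by (rule dvd_imp_le)
  have pb: "\<not> p dvd b"
    using b(2) pP p by (metis coprime_commute coprime_absorb_left not_prime_unit)
  define e where "e = multiplicity p m"
  obtain m1 where m1: "m = p ^ e * m1" "\<not> p dvd m1"
    using multiplicity_decompose'[of m p] m p not_prime_unit unfolding e_def by (metis not_one_less_zero)
  have m10: "m1 > 0" using m m1 by (auto intro!: Nat.gr0I)
  have "m1 \<in> integers_over (P - {p})"
    using m(1) m10 m1 by (auto simp: integers_over_def)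
  moreover have "finite (P - {p})" "\<forall>q\<in>P - {p}. prime q" using P by auto
  ultimately obtain Y where Y: "Y > 0" "\<And>q. prime q \<Longrightarrow> q dvd Y \<Longrightarrow> q \<in> P - {p}" "m1 dvd Y ^ r"
    "Y ^ r \<le> m1 * (\<Prod>(P - {p})) ^ r"
    using integers_over_approx_root[of "P - {p}" m1 r] r by blast
  have pY: "\<not> p dvd Y" using Y(2)[OF p] by blast

  \<comment> \<open>Being 1 modulo the square of the product of P, x supplies the valuation at least
    2 from which lifting at p can start.\<close>
  define x where "x = int b ^ T0"
  define \<beta> where "\<beta> = multiplicity (int p) (x - 1)"
  have x1: "x - 1 > 0" using b(1) T0(1) unfolding x_def by (simp add: one_less_power)
  have Rx: "int (R\<^sup>2) dvd x - 1"
    using T0(2) unfolding x_def R_def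
    by (metis cong_iff_dvd_diff cong_int_iff of_nat_1 of_nat_power)
  have p_int: "prime (int p)" using p by simp
  have p2: "int p ^ 2 dvd x - 1"
    using Rx pR by (metis dvd_power_same dvd_trans int_dvd_int_iff of_nat_power)
  have \<beta>2: "\<beta> \<ge> 2"
    unfolding \<beta>_def using p2 x1 p_int by (intro multiplicity_geI) (auto simp: not_prime_unit)
  \<comment> \<open>Crude, but free of \<open>m\<close>: \<beta> < 2^\<beta> \<le> p^\<beta> \<le> x
    - 1.\<close>
  have \<beta>b: "\<beta> \<le> b ^ T0"
  proof -
    have "int p ^ \<beta> dvd x - 1" unfolding \<beta>_def by (rule multiplicity_dvd)
    then have "int p ^ \<beta> \<le> x - 1" using x1 by (rule zdvd_imp_le)
    then have "int (p ^ \<beta>) \<le> int (b ^ T0)" by (simp add: x_def)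
    then have "p ^ \<beta> \<le> b ^ T0" by (simp only: of_nat_le_iff)
    moreover have "\<beta> < 2 ^ \<beta>" by (rule less_exp)
    moreover have "2 ^ \<beta> \<le> p ^ \<beta>" using prime_ge_2_nat[OF p] by (intro power_mono) auto
    ultimately show ?thesis by linarith
  qed
  obtain y0 where y0: "x - 1 = int p ^ \<beta> * y0" "\<not> int p dvd y0"
    using multiplicity_decompose'[of "x - 1" "int p"] x1 p_int not_prime_unit unfolding \<beta>_def
    by (metis less_irrefl)

  \<comment> \<open>Taking logarithms of m \<le> p^(e card P) and using log p \<le> R makes the size
    hypothesis a lower bound for e.\<close>
  have e_large: "w0 + r * \<beta> + r * W \<le> e"
  proof -
    have "real m \<le> (real p ^ e) ^ card P" using pm unfolding e_def[symmetric] by (metis of_nat_le_iff of_nat_power)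
    then have "ln (real m) \<le> ln ((real p ^ e) ^ card P)" using m by simp
    also have "\<dots> = real (card P) * (real e * ln (real p))" using p0 by (simp add: ln_realpow)
    also have "\<dots> \<le> real (card P) * (real e * real R)"
    proof (intro mult_left_mono)
      have "ln (real p) \<le> real p" using p0 ln_le_minus_one[of "real p"] by simp
      then show "ln (real p) \<le> real R" using pleR by linarith
    qed auto
    finally have "real (card P) * real R * real (w0 + r * b ^ T0 + r * W) \<le> real (card P) * real R * real e"
      using size unfolding R_def[symmetric] w0_def r_def W_def by (simp add: mult_ac)
    moreover have "real (card P) * real R > 0"
    proof -
      have "card P > 0" using P(1) pP by (auto simp: card_gt_0_iff)
      then show ?thesis using R0 by simp
    qed
    ultimately have "w0 + r * b ^ T0 + r * W \<le> e"
      by (meson mult_le_cancel_left_pos of_nat_le_iff)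
    moreover have "r * \<beta> \<le> r * b ^ T0" using \<beta>b by simp
    ultimately show ?thesis by linarith
  qed
  \<comment> \<open>Of the exponent e, w0 is set aside and the rest is divided evenly among the r
    factors; the remainder, less than r, goes into \<open>w\<close>.\<close>
  define t where "t = (e - w0 - r * \<beta>) div r"
  define w where "w = e - r * (\<beta> + t)"
  define s where "s = \<beta> + t"
  have rt: "r * t \<le> e - w0 - r * \<beta>" "e - w0 - r * \<beta> < r * t + r"
    unfolding t_def using dividend_less_times_div[OF r, of "e - w0 - r * \<beta>"] by (simp_all add: add.commute)
  have w: "e = r * s + w" "w0 \<le> w" "w \<le> W"
    using rt e_large unfolding w_def s_def W_def by (auto simp: algebra_simps)
  have Ws: "W \<le> s"
  proof -
    have "W \<le> t" unfolding t_def using e_large r by (simp add: less_eq_div_iff_mult_less_eq mult.commute)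
    then show ?thesis by (simp add: s_def)
  qed

  \<comment> \<open>The exponent p^t raises the valuation of x - 1 at p from \<beta> to s. The
    exponent \<open>Y\<close>, prime to p, leaves it unchanged and forces divisibility by Y.\<close>
  define T where "T = T0 * (p ^ t * Y)"
  have T: "T > 0" using T0 p0 Y(1) by (simp add: T_def)
  have lift: "\<exists>c. (int b ^ T) ^ h - 1 = int p ^ (s + multiplicity p h) * int Y * c \<and> \<not> int p dvd c"
    if h0: "h > 0" for h
  proof -
    have G: "int b ^ T = x ^ (p ^ t * Y)" by (simp add: T_def x_def power_mult)
    obtain c where c: "int b ^ T - 1 = int p ^ s * y0 * c" "\<not> int p dvd c"
      using power_diff_1_lifting[OF p \<beta>2 y0(1) pY, of t] unfolding G s_def by blast
    have "int Y dvd (x ^ p ^ t) ^ Y - 1"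
    proof (rule dvd_power_self_diff_1)
      fix q assume q: "prime q" "q dvd Y"
      then have "q dvd R" using Y(2) P(1) unfolding R_def by (intro dvd_prodI) auto
      then have "q dvd R\<^sup>2" by (simp add: power2_eq_square)
      then have "int q dvd x - 1" using Rx int_dvd_int_iff dvd_trans by blast
      then show "int q dvd x ^ p ^ t - 1" unfolding power_minus_1_eq[of x "p ^ t"] by simp
    qed
    then have "int Y dvd int p ^ s * (y0 * c)" using c(1) by (simp add: G power_mult mult.assoc)
    moreover have "coprime (int Y) (int p ^ s)"
      using prime_imp_coprime[OF p pY] by (simp add: coprime_commute)
    ultimately have "int Y dvd y0 * c" by (simp add: coprime_dvd_mult_right_iff)
    then obtain c' where c': "y0 * c = int Y * c'" by (elim dvdE)
    have "\<not> int p dvd c'"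
      using c' c(2) y0(2) p_int by (metis dvd_mult prime_dvd_mult_iff)
    have G1: "int b ^ T - 1 = int p ^ s * (int Y * c')" using c(1) c' by (simp add: mult.assoc)
    have s2: "s \<ge> 2" using \<beta>2 by (simp add: s_def)
    obtain d where d: "(int b ^ T) ^ h - 1 = int p ^ (s + multiplicity p h) * (int Y * c') * d" "\<not> int p dvd d"
      using power_diff_1_lifting_multiplicity[OF p s2 G1 h0] by blast
    have "\<not> int p dvd c' * d" using d(2) \<open>\<not> int p dvd c'\<close> p_int by (simp add: prime_dvd_mult_iff)
    then show ?thesis using d(1) by (intro exI[of _ "c' * d"]) (simp add: mult.assoc)
  qed

  \<comment> \<open>Compared by r-th powers: p^(t r) \<le> p^e and Y^r \<le> m1 R^r multiply to at
    most m R^r.\<close>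
  have T_le: "real T \<le> real T0 * real R * real m powr (1 / real r)"
  proof -
    have "p ^ (t * r) \<le> p ^ e"
      using rt p0 by (intro power_increasing) (auto simp: mult.commute)
    moreover have "\<Prod>(P - {p}) \<le> R"
    proof -
      have "R = p * \<Prod>(P - {p})" unfolding R_def by (rule prod.remove[OF P(1) pP])
      then show ?thesis using p0 by simp
    qed
    then have "Y ^ r \<le> m1 * R ^ r"
      using Y(4) by (meson le_trans mult_le_mono2 power_mono zero_le)
    ultimately have "p ^ (t * r) * Y ^ r \<le> p ^ e * (m1 * R ^ r)" by (intro mult_mono) auto
    then have "T0 ^ r * (p ^ (t * r) * Y ^ r) \<le> T0 ^ r * (p ^ e * (m1 * R ^ r))" by simp
    also have "T0 ^ r * (p ^ (t * r) * Y ^ r) = T ^ r"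
      by (simp add: T_def power_mult_distrib power_mult)
    also have "T0 ^ r * (p ^ e * (m1 * R ^ r)) = (T0 * R) ^ r * m"
      by (simp add: m1(1) power_mult_distrib)
    finally have "real T ^ r \<le> (real T0 * real R) ^ r * real m"
      by (metis of_nat_le_iff of_nat_mult of_nat_power)
    also have "\<dots> = (real T0 * real R * real m powr (1 / real r)) ^ r"
      using m(2) r by (simp add: power_mult_distrib powr_realpow[symmetric] powr_powr)
    finally show ?thesis using r by (simp add: power_mono_iff)
  qed

  define v where "v = multiplicity p h"
  have vV: "v \<le> V" unfolding v_def by (rule multiplicity_power_le[OF p h])
  obtain h' where h': "h = p ^ v * h'" "\<not> p dvd h'"
    using multiplicity_decompose'[of h p] h p not_prime_unit unfolding v_def by (metis less_irrefl)
  obtain z1 where z1: "Y ^ r = m1 * z1" using Y(3) by (elim dvdE)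
  have z1p: "\<not> p dvd z1"
    using z1 pY p by (metis dvd_mult prime_dvd_power)
  have "e > 0" using e_large V unfolding w0_def by (cases e) auto
  then have "p dvd m" using m1(1) by simp
  then have ap: "\<not> p dvd a" using a p by (metis coprime_common_divisor not_prime_unit)
  define \<alpha> where "\<alpha> = int (h' * a * z1)"
  have \<alpha>p: "\<not> int p dvd \<alpha>"
    using h'(2) ap z1p p unfolding \<alpha>_def int_dvd_int_iff by (simp add: prime_dvd_mult_iff)
  have vw: "v \<le> w" using vV w(2) unfolding w0_def by simp
  \<comment> \<open>The factor p^v cancels between h and m, and m1 is completed to Y^r by
    \<open>z1\<close>. This cofactor moves into \<alpha> and is prime to p because it divides
    Y^r.\<close>
  have phase: "real h * (real (a * b ^ n) / real m) =
    of_int (\<alpha> * int b ^ n) / (real p ^ ((j + 1) * s + (w - v)) * real Y ^ (j + 1))" for n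
  proof -
    have "e = (j + 1) * s + (w - v) + v" using w(1) vw by (simp add: r_def)
    then have "real m = real p ^ ((j + 1) * s + (w - v)) * real p ^ v * real m1"
      by (simp add: m1(1) power_add)
    moreover have "real Y ^ (j + 1) = real m1 * real z1"
      using z1 unfolding r_def by (metis of_nat_mult of_nat_power)
    moreover have "z1 > 0" using z1 Y(1) by (auto intro!: Nat.gr0I)
    ultimately show ?thesis
      using p0 m10 by (simp add: h'(1) \<alpha>_def field_simps)
  qed
  show ?thesis
    unfolding phase
  proof (rule exponential_sum_bound[OF p pb Y(1) T lift])
    show "1 \<le> \<eta> * real p ^ V"
    proof -
      have "(2::real) ^ V \<le> real p ^ V" using prime_ge_2_nat[OF p] by (intro power_mono) auto
      then have "\<eta> * 2 ^ V \<le> \<eta> * real p ^ V" using \<eta>(1) by (intro mult_left_mono) auto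
      then show ?thesis using \<eta>(3) by linarith
    qed
    show "real p ^ W * real T \<le> \<eta> * real N"
    proof -
      have "real p ^ W * real T \<le> real R ^ W * (real T0 * real R * real m powr (1 / real r))"
        using pleR T_le by (intro mult_mono power_mono) auto
      also have "\<dots> \<le> \<eta> * real N" using N unfolding R_def W_def w0_def r_def .
      finally show ?thesis .
    qed
    show "(j + 1) * V \<le> w - v" using w(2) vV unfolding w0_def by simp
    show "w - v \<le> W" using w(3) by simp
  qed (use \<eta> V Ws \<alpha>p in auto)
qed

subsection \<open>Choice of parameters\<close>

text \<open>Here r is replaced by log_2 L + 1 and V by 2 L / (ln L)^3 + 1; the dominant product r^2
  V has order L / ln L.\<close>

lemma eventually_size_condition:
  fixes K B :: real
  assumes "K > 0" "B > 0"
  shows "\<forall>\<^sub>F L :: real in at_top. K * ((log 2 L + 2) * (2 * L / ln L ^ 3 + 1) + (log 2 L + 1) * B +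
    (log 2 L + 1) * ((log 2 L + 2) * (2 * L / ln L ^ 3 + 1) + (log 2 L + 1))) \<le> L"
  using assms by real_asymp

text \<open>This is where the gap \<epsilon>/2 is spent: apart from m^(1/r), the logarithm of every
  factor is of smaller order than L / log_2 L.\<close>

lemma eventually_length_condition:
  fixes A A' \<epsilon> :: real
  assumes "A > 0" "A' > 0" "\<epsilon> > 0"
  shows "\<forall>\<^sub>F L :: real in at_top. A * ((log 2 L + 2) * (2 * L / ln L ^ 3 + 1) + (log 2 L + 1)) + A' +
    (1 + \<epsilon> / 2) * L / log 2 L + L / ln L ^ 3 \<le> (1 + \<epsilon>) * L / log 2 L"
proof -
  have "\<forall>\<^sub>F L :: real in at_top. A * ((log 2 L + 2) * (2 * L / ln L ^ 3 + 1) + (log 2 L + 1)) + A' +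
    L / ln L ^ 3 \<le> \<epsilon> / 2 * L / log 2 L"
    using assms by real_asymp
  then show ?thesis
  proof eventually_elim
    case (elim L)
    have "(1 + \<epsilon>) * L = (1 + \<epsilon> / 2) * L + \<epsilon> / 2 * L" by (simp add: algebra_simps)
    then have "(1 + \<epsilon>) * L / log 2 L = (1 + \<epsilon> / 2) * L / log 2 L + \<epsilon> / 2 * L / log 2 L"
      by (simp only: add_divide_distrib)
    with elim show ?case by linarith
  qed
qed

text \<open>Guarantees that all frequencies used in the discrepancy bound lie below 2^V.\<close>

lemma eventually_threshold_condition:
  "\<forall>\<^sub>F L :: real in at_top. exp (2 * ln L powr (3 / 2)) + 1 \<le> exp (L / ln L ^ 3)"
  by real_asymp

text \<open>Because \<mu> < 1, a positive power of L survives the repeated square roots and outgrows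
  any power of ln L.\<close>

lemma eventually_saving_condition:
  fixes \<mu> :: real
  assumes "\<mu> < 1" "\<mu> > 0"
  shows "\<forall>\<^sub>F L :: real in at_top. ln 10 + 3 * ln L powr (3 / 2) \<le> L / ln L ^ 3 * L powr (- \<mu>)"
  using assms by real_asymp

text \<open>The constants \<open>K\<close>, \<open>R\<close>, \<open>B\<close>, \<open>A\<close>
  stand for quantities determined by P and b, so that only L = log m varies.\<close>

lemma eventually_weyl_parameters:
  fixes K R B A :: real and \<epsilon> :: real
  assumes "K > 0" "R \<ge> 1" "B > 0" "A > 0" and \<epsilon>: "0 < \<epsilon>"
  shows "\<forall>\<^sub>F L in at_top. \<exists>(j::nat) (V::nat) (\<eta>::real).
    1 \<le> V \<and> 0 < \<eta> \<and> \<eta> \<le> 1 \<and> 1 \<le> \<eta> * 2 ^ V \<and>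
    K * (real ((j + 2) * V) + real (j + 1) * B + real (j + 1) * real ((j + 2) * V + (j + 1))) \<le> L \<and>
    R ^ ((j + 2) * V + (j + 1)) * (A * exp (L / real (j + 1))) \<le> \<eta> * exp ((1 + \<epsilon>) * L / log 2 L) \<and>
    exp (2 * ln L powr (3 / 2)) + 1 \<le> 2 ^ V \<and>
    10 * \<eta> powr ((1 / 2) ^ j) \<le> exp (- 3 * ln L powr (3 / 2))"
proof -
  define \<mu> where "\<mu> = 1 / (1 + \<epsilon> / 2)"
  have \<mu>: "\<mu> < 1" "\<mu> > 0" using \<epsilon> by (simp_all add: \<mu>_def)
  have R0: "R > 0" using assms(2) by simp
  have "\<forall>\<^sub>F L :: real in at_top. L > 1" by (rule eventually_gt_at_top)
  then show ?thesis
    using eventually_size_condition[OF assms(1,3)] eventually_length_condition[OF R0 assms(4) \<epsilon>]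
      eventually_threshold_condition eventually_saving_condition[OF \<mu>]
  proof eventually_elim
    case (elim L)
    define x where "x = log 2 L"
    \<comment> \<open>The factor 2 offsets the estimate 2 \<ge> e^(1/2), through which 2^V \<ge>
      e^(V/2) \<ge> 1/\<eta>.\<close>
    define v where "v = 2 * L / ln L ^ 3"
    \<comment> \<open>Rounding down keeps 2^j \<le> L^\<mu>, while j + 1 > \<mu> log_2 L keeps L /
      (j + 1) below (1 + \<epsilon>/2) L / log_2 L.\<close>
    define j where "j = nat \<lfloor>\<mu> * x\<rfloor>"
    define V where "V = nat \<lceil>v\<rceil>"
    define \<eta> where "\<eta> = exp (- L / ln L ^ 3)"
    have L: "L > 1" by (rule elim(1))
    then have lnL: "ln L > 0" by simp
    have x: "x > 0" using L by (simp add: x_def)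
    have \<mu>x: "0 \<le> \<mu> * x" "\<mu> * x \<le> x" using x \<mu> by (auto intro: mult_left_le_one_le)
    have j: "real j \<le> \<mu> * x" "\<mu> * x < real j + 1" using \<mu>x by (simp_all add: j_def)
    have jx: "real j \<le> x" using j \<mu>x by linarith
    have v: "v > 0" using L lnL by (simp add: v_def)
    have V: "v \<le> real V" "real V \<le> v + 1" unfolding V_def using v by linarith+
    have V1: "1 \<le> V" using v V(1) by (cases V) auto
    have jV: "real ((j + 2) * V) \<le> (x + 2) * (v + 1)"
    proof -
      have "real (j + 2) * real V \<le> (x + 2) * (v + 1)"
        using jx V v x by (intro mult_mono) auto
      then show ?thesis by (simp only: of_nat_mult)
    qed
    have exp2: "exp (L / ln L ^ 3) \<le> 2 ^ V"
    proof -
      have "exp (1 / 2 :: real) \<le> 2"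
      proof (rule power2_le_imp_le)
        show "(exp (1 / 2 :: real))\<^sup>2 \<le> 2\<^sup>2" using exp_le by (simp add: power2_eq_square flip: exp_add)
      qed simp
      then have "exp (1 / 2 :: real) ^ V \<le> 2 ^ V" by (intro power_mono) auto
      moreover have "exp (L / ln L ^ 3) \<le> exp (real V * (1 / 2))" using V(1) by (simp add: v_def mult.commute)
      ultimately show ?thesis by (simp only: exp_of_nat_mult)
    qed
    have "1 \<le> \<eta> * 2 ^ V"
    proof -
      have "\<eta> * exp (L / ln L ^ 3) \<le> \<eta> * 2 ^ V"
        using exp2 by (intro mult_left_mono) (auto simp: \<eta>_def)
      then show ?thesis by (simp add: \<eta>_def flip: exp_add)
    qed
    moreover have "K * (real ((j + 2) * V) + real (j + 1) * B + real (j + 1) * real ((j + 2) * V + (j + 1))) \<le> L"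
    proof -
      have "real ((j + 2) * V) + real (j + 1) * B + real (j + 1) * real ((j + 2) * V + (j + 1)) \<le>
        (x + 2) * (v + 1) + (x + 1) * B + (x + 1) * ((x + 2) * (v + 1) + (x + 1))"
        using jV jx x assms by (intro add_mono mult_mono) auto
      then have "K * (real ((j + 2) * V) + real (j + 1) * B + real (j + 1) * real ((j + 2) * V + (j + 1))) \<le>
        K * ((x + 2) * (v + 1) + (x + 1) * B + (x + 1) * ((x + 2) * (v + 1) + (x + 1)))"
        using assms by (intro mult_left_mono) auto
      also have "\<dots> \<le> L" using elim(2) by (simp only: x_def v_def)
      finally show ?thesis .
    qed
    moreover have "R ^ ((j + 2) * V + (j + 1)) * (A * exp (L / real (j + 1))) \<le> \<eta> * exp ((1 + \<epsilon>) * L / log 2 L)"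
    proof -
      have "R ^ ((j + 2) * V + (j + 1)) = exp (real ((j + 2) * V + (j + 1)) * ln R)"
        using assms(2) by (subst exp_of_nat_mult) simp
      also have "\<dots> \<le> exp (R * ((x + 2) * (v + 1) + (x + 1)))"
      proof -
        have "real ((j + 2) * V + (j + 1)) * ln R \<le> ((x + 2) * (v + 1) + (x + 1)) * R"
          using jV jx x v assms(2) ln_le_minus_one[of R] by (intro mult_mono) auto
        then show ?thesis by (simp add: mult.commute)
      qed
      finally have 1: "R ^ ((j + 2) * V + (j + 1)) \<le> exp (R * ((x + 2) * (v + 1) + (x + 1)))" .
      have "A \<le> exp A" using exp_ge_add_one_self[of A] by linarith
      moreover have "L / real (j + 1) \<le> (1 + \<epsilon> / 2) * L / x"
      proof -
        have "L / real (j + 1) \<le> L / (\<mu> * x)"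
          using j L x \<mu> by (intro divide_left_mono) auto
        then show ?thesis by (simp add: \<mu>_def mult.commute)
      qed
      then have "exp (L / real (j + 1)) \<le> exp ((1 + \<epsilon> / 2) * L / x)" by simp
      ultimately have 2: "A * exp (L / real (j + 1)) \<le> exp A * exp ((1 + \<epsilon> / 2) * L / x)"
        using assms by (intro mult_mono) auto
      have "R ^ ((j + 2) * V + (j + 1)) * (A * exp (L / real (j + 1))) \<le>
        exp (R * ((x + 2) * (v + 1) + (x + 1))) * (exp A * exp ((1 + \<epsilon> / 2) * L / x))"
        using assms(4) by (intro mult_mono[OF 1 2]) auto
      also have "\<dots> = exp (R * ((x + 2) * (v + 1) + (x + 1)) + A + (1 + \<epsilon> / 2) * L / x)"
        by (simp add: exp_add)
      also have "\<dots> \<le> exp (- L / ln L ^ 3 + (1 + \<epsilon>) * L / log 2 L)"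
      proof -
        have "R * ((x + 2) * (v + 1) + (x + 1)) + A + (1 + \<epsilon> / 2) * L / x + L / ln L ^ 3 \<le> (1 + \<epsilon>) * L / log 2 L"
          using elim(3) assms(2) by (simp only: x_def v_def)
        then show ?thesis by simp
      qed
      also have "\<dots> = \<eta> * exp ((1 + \<epsilon>) * L / log 2 L)" by (simp only: exp_add \<eta>_def)
      finally show ?thesis .
    qed
    moreover have "exp (2 * ln L powr (3 / 2)) + 1 \<le> 2 ^ V" using elim(4) exp2 by linarith
    moreover have "10 * \<eta> powr ((1 / 2) ^ j) \<le> exp (- 3 * ln L powr (3 / 2))"
    proof -
      have "L powr (- \<mu>) = 2 powr (- (\<mu> * x))"
        using L by (simp add: x_def powr_def log_def)
      also have "\<dots> \<le> 2 powr (- real j)" using j by (intro powr_mono) auto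
      also have "\<dots> = (1 / 2) ^ j" by (simp add: powr_minus powr_realpow power_one_over inverse_eq_divide)
      finally have "L / ln L ^ 3 * L powr (- \<mu>) \<le> L / ln L ^ 3 * (1 / 2) ^ j"
        using L lnL by (intro mult_left_mono) auto
      then have "ln 10 + 3 * ln L powr (3 / 2) \<le> L / ln L ^ 3 * (1 / 2) ^ j"
        using elim(5) by linarith
      moreover have "10 * \<eta> powr ((1 / 2) ^ j) = exp (ln 10 - L / ln L ^ 3 * (1 / 2) ^ j)"
      proof -
        have "\<eta> powr ((1 / 2) ^ j) = exp ((1 / 2) ^ j * (- L / ln L ^ 3))"
          unfolding \<eta>_def powr_def ln_exp by simp
        also have "(1 / 2) ^ j * (- L / ln L ^ 3) = - (L / ln L ^ 3 * (1 / 2) ^ j)" by simp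
        finally have "\<eta> powr ((1 / 2) ^ j) = exp (- (L / ln L ^ 3 * (1 / 2) ^ j))" .
        moreover have "10 * exp (- z) = exp (ln 10 - z)" for z :: real
          by (simp add: exp_diff exp_minus divide_inverse)
        ultimately show ?thesis by simp
      qed
      ultimately show ?thesis by simp
    qed
    moreover have "0 < \<eta>" "\<eta> \<le> 1" using L lnL by (simp_all add: \<eta>_def)
    ultimately show ?case using V1 by blast
  qed
qed

subsection \<open>Counting strings\<close>

text \<open>With H about \<Delta>^(-2) and l about \<Delta> m, the errors l/m, H \<Delta>^3 and m/(H
  l) are all of order \<Delta>; this is why the sums must save \<Delta>^3. The constant is 37 = 2 (2
  + 8 + 8) + 1, the last 1 coming from the rounding of the interval.\<close>

lemma string_count_discrepancy:
  fixes b m a N :: nat and s :: "nat list" and \<Delta> :: real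
  assumes m: "m > 0" and b: "b > 0" and s: "base_string b s"
    and \<Delta>: "0 < \<Delta>" "\<Delta> \<le> 1" "1 / real m \<le> \<Delta>"
    and E: "\<And>h. 1 \<le> h \<Longrightarrow> real h \<le> 1 / \<Delta>\<^sup>2 + 1 \<Longrightarrow>
      norm (\<Sum>n<N. unit_exp (real h * (real (a * b ^ n) / real m))) \<le> real N * \<Delta> ^ 3"
  shows "\<bar>real (string_count b a m s N) - 1 / real b ^ length s * real N\<bar> \<le> 37 * (real N * \<Delta>)"
proof -
  obtain u v where uv: "u \<le> v" "v \<le> m" "\<bar>(real v - real u) - real m / real b ^ length s\<bar> \<le> 1"
    and count: "string_count b a m s N = card {n. n < N \<and> u \<le> a * b ^ n mod m \<and> a * b ^ n mod m < v}"
    using string_count_eq_interval_count[OF m b s, of a N] by blast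
  define H where "H = nat \<lceil>1 / \<Delta>\<^sup>2\<rceil>"
  define l where "l = nat \<lceil>\<Delta> * real m\<rceil>"
  have m1: "1 \<le> \<Delta> * real m" using \<Delta>(3) m by (simp add: field_simps)
  have \<Delta>2: "1 \<le> 1 / \<Delta>\<^sup>2" using \<Delta> by (simp add: power_le_one)
  have H: "1 / \<Delta>\<^sup>2 \<le> real H" "real H \<le> 1 / \<Delta>\<^sup>2 + 1"
    unfolding H_def using \<Delta>2 by linarith+
  have H0: "H > 0" using H(1) \<Delta>2 by (cases H) auto
  have l: "\<Delta> * real m \<le> real l" "real l \<le> \<Delta> * real m + 1"
    unfolding l_def using m1 by linarith+
  have l0: "l > 0" using l(1) m1 by (cases l) auto
  have "\<bar>real (card {n. n < N \<and> u \<le> a * b ^ n mod m \<and> a * b ^ n mod m < v}) - real N * (real v - real u) / real m\<bar> \<le>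
    2 * (real N * real l / real m + 4 * real H * (real N * \<Delta> ^ 3) + 8 * real N * real m / (real H * real l))"
  proof (rule count_interval_discrepancy[OF m uv(1,2) l0 H0])
    fix h assume h: "1 \<le> h" "h \<le> H"
    have "unit_exp (real h * (real (a * b ^ n mod m) / real m)) = unit_exp (real h * (real (a * b ^ n) / real m))" for n
    proof -
      have "[int h * int (a * b ^ n mod m) = int h * int (a * b ^ n)] (mod int m)"
        by (intro cong_mult cong_refl) (simp add: cong_def zmod_int)
      from unit_exp_cong[OF this] show ?thesis by simp
    qed
    moreover have "real h \<le> 1 / \<Delta>\<^sup>2 + 1" using h H by linarith
    ultimately show "norm (\<Sum>n<N. unit_exp (real h * (real (a * b ^ n mod m) / real m))) \<le> real N * \<Delta> ^ 3"
      using E[OF h(1)] by simp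
  qed (use m in simp)
  also have "\<dots> \<le> 2 * (2 * (real N * \<Delta>) + 8 * (real N * \<Delta>) + 8 * (real N * \<Delta>))"
  proof (intro mult_left_mono add_mono)
    have "real l / real m \<le> 2 * \<Delta>"
      using l(2) m1 m by (simp add: divide_le_eq)
    then have "real N * (real l / real m) \<le> real N * (2 * \<Delta>)" by (intro mult_left_mono) auto
    then show "real N * real l / real m \<le> 2 * (real N * \<Delta>)" by simp
    have "real H \<le> 2 / \<Delta>\<^sup>2" using H \<Delta>2 by simp
    then have "real H * \<Delta> ^ 3 \<le> 2 / \<Delta>\<^sup>2 * \<Delta> ^ 3" using \<Delta> by (intro mult_right_mono) auto
    also have "\<dots> = 2 * \<Delta>" using \<Delta> by (simp add: eval_nat_numeral)
    finally have "4 * real N * (real H * \<Delta> ^ 3) \<le> 4 * real N * (2 * \<Delta>)" by (intro mult_left_mono) auto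
    then show "4 * real H * (real N * \<Delta> ^ 3) \<le> 8 * (real N * \<Delta>)" by (simp add: mult_ac)
    have "1 / \<Delta>\<^sup>2 * (\<Delta> * real m) \<le> real H * real l" using H l m1 by (intro mult_mono) auto
    then have "real m / \<Delta> \<le> real H * real l" using \<Delta> by (simp add: power2_eq_square)
    then have "real m \<le> \<Delta> * (real H * real l)" using \<Delta> by (simp add: divide_le_eq mult_ac)
    then have "real m / (real H * real l) \<le> \<Delta>" using H0 l0 by (simp add: divide_le_eq)
    then have "8 * real N * (real m / (real H * real l)) \<le> 8 * real N * \<Delta>" by (intro mult_left_mono) auto
    then show "8 * real N * real m / (real H * real l) \<le> 8 * (real N * \<Delta>)" by simp
  qed simp
  finally have 1: "\<bar>real (string_count b a m s N) - real N * (real v - real u) / real m\<bar> \<le> 36 * (real N * \<Delta>)"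
    unfolding count by (simp add: mult.commute)
  have "\<bar>real N * (real v - real u) / real m - 1 / real b ^ length s * real N\<bar> =
    real N / real m * \<bar>(real v - real u) - real m / real b ^ length s\<bar>"
  proof -
    have "real N * (real v - real u) / real m - 1 / real b ^ length s * real N =
      real N / real m * ((real v - real u) - real m / real b ^ length s)"
      using m by (simp add: right_diff_distrib diff_divide_distrib)
    then show ?thesis by (simp only: abs_mult) simp
  qed
  also have "\<dots> \<le> real N / real m * 1" using uv(3) by (intro mult_left_mono) auto
  also have "\<dots> = real N * (1 / real m)" by simp
  also have "\<dots> \<le> real N * \<Delta>" using \<Delta>(3) by (intro mult_left_mono) auto
  finally show ?thesis using 1 by linarith
qed

lemma string_count_integers_over:
  fixes P :: "nat set" and b :: nat and \<epsilon> :: real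
  assumes P: "finite P" "\<forall>p\<in>P. prime p" and b: "2 \<le> b" "\<forall>p\<in>P. coprime b p" and \<epsilon>: "0 < \<epsilon>"
  shows "\<forall>\<^sub>F m in sequentially. m \<in> integers_over P \<longrightarrow> (\<forall>a s N. coprime a m \<and> base_string b s \<and>
    exp ((1 + \<epsilon>) * ln (real m) / log 2 (ln (real m))) \<le> real N \<longrightarrow>
    \<bar>real (string_count b a m s N) - 1 / real b ^ length s * real N\<bar>
      \<le> 37 * (real N * exp (- (ln (ln (real m)) powr (3 / 2)))))"
proof -
  define R where "R = \<Prod>P"
  have R0: "R > 0" unfolding R_def using P prime_gt_0_nat by (auto intro!: prod_pos)
  have "coprime b (R\<^sup>2)"
    unfolding R_def using b(2) by (auto intro!: prod_coprime_right)
  \<comment> \<open>Euler's theorem provides an exponent that depends only on P.\<close>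
  define T0 where "T0 = totient (R\<^sup>2)"
  have T0: "T0 > 0" "[b ^ T0 = 1] (mod R\<^sup>2)"
    unfolding T0_def using R0 euler_theorem[OF \<open>coprime b (R\<^sup>2)\<close>] by auto
  have lim: "filterlim (\<lambda>m::nat. ln (real m)) at_top sequentially" by real_asymp
  \<comment> \<open>The summand 1 in the first factor of the size condition keeps that constant
    positive even for empty P.\<close>
  have params: "\<forall>\<^sub>F m::nat in sequentially. \<exists>(j::nat) (V::nat) (\<eta>::real).
    1 \<le> V \<and> 0 < \<eta> \<and> \<eta> \<le> 1 \<and> 1 \<le> \<eta> * 2 ^ V \<and>
    (real (card P) * real R + 1) * (real ((j + 2) * V) + real (j + 1) * real (b ^ T0) + real (j + 1) * real ((j + 2) * V + (j + 1))) \<le> ln (real m) \<and>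
    real R ^ ((j + 2) * V + (j + 1)) * (real T0 * real R * exp (ln (real m) / real (j + 1))) \<le>
      \<eta> * exp ((1 + \<epsilon>) * ln (real m) / log 2 (ln (real m))) \<and>
    exp (2 * ln (ln (real m)) powr (3 / 2)) + 1 \<le> 2 ^ V \<and>
    10 * \<eta> powr ((1 / 2) ^ j) \<le> exp (- 3 * ln (ln (real m)) powr (3 / 2))"
    by (rule eventually_compose_filterlim[OF eventually_weyl_parameters lim])
       (use R0 T0 b \<epsilon> in \<open>auto intro!: add_nonneg_pos\<close>)
  have "\<forall>\<^sub>F m::nat in sequentially. ln (ln (real m)) powr (3 / 2) \<le> ln (real m)" by real_asymp
  moreover have "\<forall>\<^sub>F m::nat in sequentially. m > 1" by (rule eventually_gt_at_top)
  ultimately show ?thesis using params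
  proof eventually_elim
    case (elim m)
    define D where "D = ln (ln (real m)) powr (3 / 2)"
    define \<Delta> where "\<Delta> = exp (- D)"
    have m: "m > 1" by (rule elim(2))
    obtain j V :: nat and \<eta> :: real where V: "1 \<le> V" and \<eta>: "0 < \<eta>" "\<eta> \<le> 1" "1 \<le> \<eta> * 2 ^ V"
      and size: "(real (card P) * real R + 1) * (real ((j + 2) * V) + real (j + 1) * real (b ^ T0) + real (j + 1) * real ((j + 2) * V + (j + 1))) \<le> ln (real m)"
      and len: "real R ^ ((j + 2) * V + (j + 1)) * (real T0 * real R * exp (ln (real m) / real (j + 1))) \<le>
        \<eta> * exp ((1 + \<epsilon>) * ln (real m) / log 2 (ln (real m)))"
      and H: "exp (2 * D) + 1 \<le> 2 ^ V" and saving: "10 * \<eta> powr ((1 / 2) ^ j) \<le> exp (- 3 * D)"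
      using elim(3) unfolding D_def by blast
    have size': "real (card P) * real R * real ((j + 2) * V + (j + 1) * b ^ T0 + (j + 1) * ((j + 2) * V + (j + 1))) \<le> ln (real m)"
    proof -
      define X where "X = real ((j + 2) * V) + real (j + 1) * real (b ^ T0) + real (j + 1) * real ((j + 2) * V + (j + 1))"
      have "X \<ge> 0" unfolding X_def by (intro add_nonneg_nonneg mult_nonneg_nonneg of_nat_0_le_iff)
      then have "real (card P) * real R * X \<le> (real (card P) * real R + 1) * X" by (simp add: distrib_right)
      also have "\<dots> \<le> ln (real m)" using size unfolding X_def .
      finally show ?thesis unfolding X_def by (simp only: of_nat_add of_nat_mult)
    qed
    have "\<bar>real (string_count b a m s N) - 1 / real b ^ length s * real N\<bar> \<le> 37 * (real N * \<Delta>)"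
      if mP: "m \<in> integers_over P" and a: "coprime a m" and s: "base_string b s"
        and N: "exp ((1 + \<epsilon>) * ln (real m) / log 2 (ln (real m))) \<le> real N" for a s N
    proof (rule string_count_discrepancy)
      show "1 / real m \<le> \<Delta>"
      proof -
        have "1 / real m = exp (- ln (real m))" using m by (simp add: exp_minus inverse_eq_divide)
        also have "\<dots> \<le> \<Delta>" using elim(1) by (simp add: \<Delta>_def D_def)
        finally show ?thesis .
      qed
      have "D \<ge> 0" by (simp add: D_def)
      then show "\<Delta> \<le> 1" by (simp add: \<Delta>_def)
      fix h :: nat assume h: "1 \<le> h" "real h \<le> 1 / \<Delta>\<^sup>2 + 1"
      have "1 / \<Delta>\<^sup>2 = exp (2 * D)"
        by (simp add: \<Delta>_def exp_minus power2_eq_square field_simps flip: exp_add)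
      then have "real h \<le> 2 ^ V" using h(2) H by linarith
      then have hV: "h \<le> 2 ^ V" by (metis of_nat_le_iff of_nat_numeral of_nat_power)
      have len': "real R ^ ((j + 2) * V + (j + 1)) * (real T0 * real R * real m powr (1 / real (j + 1))) \<le> \<eta> * real N"
      proof -
        have "real m powr (1 / real (j + 1)) = exp (ln (real m) / real (j + 1))"
          using m by (simp add: powr_def)
        then have "real R ^ ((j + 2) * V + (j + 1)) * (real T0 * real R * real m powr (1 / real (j + 1))) \<le>
          \<eta> * exp ((1 + \<epsilon>) * ln (real m) / log 2 (ln (real m)))" using len by simp
        also have "\<dots> \<le> \<eta> * real N" using N \<eta> by (intro mult_left_mono) auto
        finally show ?thesis .
      qed
      have "norm (\<Sum>n<N. unit_exp (real h * (real (a * b ^ n) / real m))) \<le> 10 * real N * \<eta> powr ((1 / 2) ^ j)"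
        using h(1) by (intro exponential_sum_bound_integers_over[OF P b T0[unfolded R_def] mP m a _ hV V \<eta>
          size'[unfolded R_def] len'[unfolded R_def]]) simp
      also have "\<dots> = real N * (10 * \<eta> powr ((1 / 2) ^ j))" by simp
      also have "\<dots> \<le> real N * exp (- 3 * D)" using saving by (intro mult_left_mono) auto
      also have "exp (- 3 * D) = \<Delta> ^ 3" by (simp add: \<Delta>_def eval_nat_numeral flip: exp_add)
      finally show "norm (\<Sum>n<N. unit_exp (real h * (real (a * b ^ n) / real m))) \<le> real N * \<Delta> ^ 3" .
    qed (use m b s in \<open>auto simp: \<Delta>_def\<close>)
    then show ?case unfolding \<Delta>_def D_def by blast
  qed
qed

theorem theorem7p2:
  fixes P :: "nat set"
  assumes "finite P" and "\<forall>p\<in>P. prime p"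
  shows "\<exists>c::real. c > 0 \<and> (\<forall>b::nat. \<forall>\<epsilon>::real.
           2 \<le> b \<and> (\<forall>p\<in>P. coprime b p) \<and> 0 < \<epsilon> \<and> \<epsilon> < 1 \<longrightarrow>
           (\<exists>C::real. \<exists>m\<^sub>0::nat. \<forall>m\<ge>m\<^sub>0. m \<in> integers_over P \<longrightarrow>
             (\<forall>(a::nat) (s::nat list) (N::nat).
                1 \<le> a \<and> a < m \<and> coprime a m \<and> base_string b s \<and>
                exp ((1 + \<epsilon>) * ln (real m) / log 2 (ln (real m))) \<le> real N \<longrightarrow>
                \<bar>real (string_count b a m s N) - 1 / real b ^ length s * real N\<bar>
                  \<le> C * (real N * exp (- c * (ln (ln (real m))) powr (3 / 2))))))"
\<comment> \<open>The choice c = 1 precedes b and \<epsilon>, which influence only the threshold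
  \<open>m\<^sub>0\<close>; the constant 37 is absolute.\<close>
proof (rule exI[of _ "1::real"], intro conjI allI impI)
  fix b :: nat and \<epsilon> :: real
  assume A: "2 \<le> b \<and> (\<forall>p\<in>P. coprime b p) \<and> 0 < \<epsilon> \<and> \<epsilon> < 1"
  then obtain m\<^sub>0 where "\<forall>m\<ge>m\<^sub>0. m \<in> integers_over P \<longrightarrow> (\<forall>a s N. coprime a m \<and> base_string b s \<and>
    exp ((1 + \<epsilon>) * ln (real m) / log 2 (ln (real m))) \<le> real N \<longrightarrow>
    \<bar>real (string_count b a m s N) - 1 / real b ^ length s * real N\<bar>
      \<le> 37 * (real N * exp (- (ln (ln (real m)) powr (3 / 2)))))"
    using string_count_integers_over[OF assms, of b \<epsilon>] unfolding eventually_sequentially by blast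
  then show "\<exists>C::real. \<exists>m\<^sub>0::nat. \<forall>m\<ge>m\<^sub>0. m \<in> integers_over P \<longrightarrow>
      (\<forall>(a::nat) (s::nat list) (N::nat).
        1 \<le> a \<and> a < m \<and> coprime a m \<and> base_string b s \<and>
        exp ((1 + \<epsilon>) * ln (real m) / log 2 (ln (real m))) \<le> real N \<longrightarrow>
        \<bar>real (string_count b a m s N) - 1 / real b ^ length s * real N\<bar>
          \<le> C * (real N * exp (- 1 * (ln (ln (real m))) powr (3 / 2))))"
    by (intro exI[of _ 37] exI[of _ m\<^sub>0]) auto
qed simp

end
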